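(* Let $L$ be a $5$-dimensional connected real Lie group with Lie algebra $\mathfrak l$, endowed with a left-invariant nearly integrable $\mathrm{SO}(3)$ structure $(g,\mathbb T)$, with adapted frame $e_1,\dots,e_5$, characteristic connection $\tilde\nabla$ and torsion three-form $T$. Put $\mathfrak h=\mathrm{span}\{e_1,e_2,e_4\}$ and $\mathfrak p=\mathrm{span}\{e_3,e_5\}$, and suppose that $$\tilde\nabla_X\mathfrak h\subseteq\mathfrak h,\quad \tilde\nabla_X\mathfrak p\subseteq\mathfrak p\quad\forall X\in\mathfrak h;\qquad \tilde\nabla_Y\mathfrak h\subseteq\mathfrak p,\quad \tilde\nabla_Y\mathfrak p\subseteq\mathfrak h\quad\forall Y\in\mathfrak p.$$ Then the torsion is coclosed, $d{*}T=0$. Moreover: a) if $(\mathfrak l,\mathfrak h)$ is a symmetric pair, then $\mathfrak l$ is either solvable or isomorphic to one of $$\mathfrak l_1=\mathfrak{so}(3)\oplus\mathbb R^2,\qquad \mathfrak l_2=(2e^{12},\ e^{14},\ e^{15}-e^{23},\ 2e^{24},\ e^{25}+e^{34}),\qquad \mathfrak l_3=\mathfrak{so}(3)\oplus\mathfrak s_2;$$ b) if $(\mathfrak l,\mathfrak h)$ is not a symmetric pair, then $\tilde\nabla\equiv0$ and $\mathfrak l$ is isomorphic to $\mathfrak{so}(3)\oplus\mathbb R^2$.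
   Context: A left-invariant $\mathrm{SO}(3)$ structure on a $5$-dimensional Lie group $L$ is given by a basis $e_1,\dots,e_5$ of the Lie algebra $\mathfrak l$ (the adapted frame, viewed as left-invariant vector fields, with dual coframe $e^1,\dots,e^5$): $g=\sum_i (e^i)^2$, and $\mathbb T$ is the left-invariant totally symmetric covariant $3$-tensor with, for $X=\sum x_ie_i$, $$\mathbb T(X,X,X)=x_1\bigl(3x_2^2+3x_4^2-x_1^2-\tfrac32x_3^2-\tfrac32x_5^2\bigr)+\tfrac{3\sqrt3}{2}x_4(x_5^2-x_3^2)+3\sqrt3\,x_2x_3x_5 .$$ With $\nabla$ the Levi-Civita connection of $g$, the structure is nearly integrable if $(\nabla_X\mathbb T)(X,X,X)=0$ for all $X$. In that case there is a unique connection $\tilde\nabla$, called the characteristic connection, with $\tilde\nabla g=0$, $\tilde\nabla\mathbb T=0$ and totally skew-symmetric torsion; its torsion three-form is $T(X,Y,Z)=g(\tilde\nabla_XY-\tilde\nabla_YX-[X,Y],Z)$. The notation $\tilde\nabla\equiv0$ means $\tilde\nabla_{e_i}e_j=0$ for all $i,j$. The pair $(\mathfrak l,\mathfrak h)$, with $\mathfrak l=\mathfrak h\oplus\mathfrak p$, is a symmetric pair if $[\mathfrak h,\mathfrak h]\subseteq\mathfrak h$, $[\mathfrak h,\mathfrak p]\subseteq\mathfrak p$, $[\mathfrak p,\mathfrak p]\subseteq\mathfrak h$. Notation: $e^{ij}=e^i\wedge e^j$; a tuple $(\alpha_1,\dots,\alpha_n)$ of two-forms denotes the Lie algebra with a dual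 basis satisfying $de^k=\alpha_k$, where $de^k(X,Y)=-e^k([X,Y])$. $\mathfrak s_2=(0,e^{12})$ is the non-Abelian $2$-dimensional Lie algebra. $*$ is the Hodge star of $g$. *)

theory Defs
  imports "HOL-Analysis.Analysis"
begin

text \<open>
  Left-invariant objects on a Lie group \<open>L\<close> are represented by their values on the Lie algebra
  \<open>\<ll>\<close>, the real vector space \<open>'l\<close> with bracket \<open>br\<close>: a left-invariant covariant \<open>k\<close>-tensor is a
  \<open>k\<close>-linear function on \<open>'l\<close>, and a left-invariant connection is a bilinear map \<open>D\<close> on \<open>'l\<close>, where
  \<open>D X Y\<close> is the derivative of the left-invariant field \<open>Y\<close> in the direction of \<open>X\<close>. A
  left-invariant tensor is constant on left-invariant fields, so all terms of the form
  \<open>X (S (Y, \<dots>))\<close> vanish in exterior and covariant derivatives.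
\<close>


section \<open>Lie algebras\<close>

definition lie_algebra :: "('l::real_vector \<Rightarrow> 'l \<Rightarrow> 'l) \<Rightarrow> bool" where
  "lie_algebra br \<longleftrightarrow>
     bilinear br \<and>
     (\<forall>X. br X X = 0) \<and>
     (\<forall>X Y Z. br X (br Y Z) + br Y (br Z X) + br Z (br X Y) = 0)"

definition derived_algebra :: "('l::real_vector \<Rightarrow> 'l \<Rightarrow> 'l) \<Rightarrow> 'l set \<Rightarrow> 'l set" where
  "derived_algebra br A = span {br X Y | X Y. X \<in> A \<and> Y \<in> A}"

definition lie_solvable :: "('l::real_vector \<Rightarrow> 'l \<Rightarrow> 'l) \<Rightarrow> bool" where
  "lie_solvable br \<longleftrightarrow> (\<exists>n. (derived_algebra br ^^ n) UNIV = {0})"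

definition symmetric_pair :: "('l::real_vector \<Rightarrow> 'l \<Rightarrow> 'l) \<Rightarrow> 'l set \<Rightarrow> 'l set \<Rightarrow> bool" where
  "symmetric_pair br h p \<longleftrightarrow>
     subspace h \<and> subspace p \<and> h \<inter> p = {0} \<and> (\<forall>X. \<exists>A\<in>h. \<exists>B\<in>p. X = A + B) \<and>
     (\<forall>X\<in>h. \<forall>Y\<in>h. br X Y \<in> h) \<and>
     (\<forall>X\<in>h. \<forall>Y\<in>p. br X Y \<in> p) \<and>
     (\<forall>X\<in>p. \<forall>Y\<in>p. br X Y \<in> h)"

text \<open>
  The model algebras may be proper subspaces \<open>W\<close> of their ambient type (\<open>\<ss>\<oo>(3)\<close> inside the
  matrices), so the target of an isomorphism is given by \<open>W\<close> together with its bracket.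
\<close>

definition lie_isomorphic ::
    "('l::real_vector \<Rightarrow> 'l \<Rightarrow> 'l) \<Rightarrow> 'm::real_vector set \<Rightarrow> ('m \<Rightarrow> 'm \<Rightarrow> 'm) \<Rightarrow> bool" where
  "lie_isomorphic br W brW \<longleftrightarrow>
     (\<exists>f. linear f \<and> bij_betw f UNIV W \<and> (\<forall>X Y. f (br X Y) = brW (f X) (f Y)))"


section \<open>Model Lie algebras\<close>

definition so3 :: "(real^3^3) set" where
  "so3 = {A. transpose A = - A}"

definition commutator :: "real^3^3 \<Rightarrow> real^3^3 \<Rightarrow> real^3^3" where
  "commutator A B = A ** B - B ** A"

definition sum_bracket ::
    "('a \<Rightarrow> 'a \<Rightarrow> 'a) \<Rightarrow> ('b \<Rightarrow> 'b \<Rightarrow> 'b) \<Rightarrow> 'a \<times> 'b \<Rightarrow> 'a \<times> 'b \<Rightarrow> 'a \<times> 'b" where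
  "sum_bracket br1 br2 X Y = (br1 (fst X) (fst Y), br2 (snd X) (snd Y))"

text \<open>\<open>wedge i j\<close> is \<open>e\<^sup>i \<and> e\<^sup>j\<close> for the standard coordinate forms. In the index type \<open>5\<close> the
  numeral \<open>5\<close> denotes the same element as \<open>0\<close>, so that \<open>1, 2, 3, 4, 5\<close> are the five indices
  (and likewise for \<open>2\<close>).\<close>

definition wedge :: "'n::finite \<Rightarrow> 'n \<Rightarrow> real^'n \<Rightarrow> real^'n \<Rightarrow> real" where
  "wedge i j X Y = X $ i * Y $ j - X $ j * Y $ i"

text \<open>By \<open>de\<^sup>k(X,Y) = - e\<^sup>k([X,Y])\<close>, the bracket of the algebra \<open>(\<alpha>\<^sub>1, \<dots>, \<alpha>\<^sub>n)\<close> is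
  minus the vector of the \<open>\<alpha>\<^sub>k(X,Y)\<close>.\<close>

definition s2_bracket :: "real^2 \<Rightarrow> real^2 \<Rightarrow> real^2" where
  "s2_bracket X Y = - vector [0, wedge 1 2 X Y]"

definition l2_bracket :: "real^5 \<Rightarrow> real^5 \<Rightarrow> real^5" where
  "l2_bracket X Y = - vector
     [2 * wedge 1 2 X Y,
      wedge 1 4 X Y,
      wedge 1 5 X Y - wedge 2 3 X Y,
      2 * wedge 2 4 X Y,
      wedge 2 5 X Y + wedge 3 4 X Y]"

definition iso_so3_plus_R2 :: "('l::real_vector \<Rightarrow> 'l \<Rightarrow> 'l) \<Rightarrow> bool" where
  "iso_so3_plus_R2 br \<longleftrightarrow>
     lie_isomorphic br (so3 \<times> (UNIV :: (real^2) set)) (sum_bracket commutator (\<lambda>_ _. 0))"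

definition iso_l2 :: "('l::real_vector \<Rightarrow> 'l \<Rightarrow> 'l) \<Rightarrow> bool" where
  "iso_l2 br \<longleftrightarrow> lie_isomorphic br UNIV l2_bracket"

definition iso_so3_plus_s2 :: "('l::real_vector \<Rightarrow> 'l \<Rightarrow> 'l) \<Rightarrow> bool" where
  "iso_so3_plus_s2 br \<longleftrightarrow>
     lie_isomorphic br (so3 \<times> (UNIV :: (real^2) set)) (sum_bracket commutator s2_bracket)"


section \<open>SO(3) structures\<close>

definition is_frame :: "(5 \<Rightarrow> 'l::real_vector) \<Rightarrow> bool" where
  "is_frame e \<longleftrightarrow> inj e \<and> independent (range e) \<and> span (range e) = UNIV"

definition coframe :: "(5 \<Rightarrow> 'l::real_vector) \<Rightarrow> 5 \<Rightarrow> 'l \<Rightarrow> real" where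
  "coframe e i X = representation (range e) X (e i)"

definition frame_metric :: "(5 \<Rightarrow> 'l::real_vector) \<Rightarrow> 'l \<Rightarrow> 'l \<Rightarrow> real" where
  "frame_metric e X Y = (\<Sum>i\<in>UNIV. coframe e i X * coframe e i Y)"

definition so3_cubic :: "(5 \<Rightarrow> 'l::real_vector) \<Rightarrow> 'l \<Rightarrow> real" where
  "so3_cubic e X =
     (let x1 = coframe e 1 X; x2 = coframe e 2 X; x3 = coframe e 3 X;
          x4 = coframe e 4 X; x5 = coframe e 5 X
      in x1 * (3 * x2\<^sup>2 + 3 * x4\<^sup>2 - x1\<^sup>2 - 3/2 * x3\<^sup>2 - 3/2 * x5\<^sup>2)
         + 3 * sqrt 3 / 2 * x4 * (x5\<^sup>2 - x3\<^sup>2)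
         + 3 * sqrt 3 * x2 * x3 * x5)"

definition symmetric_3_tensor :: "('l::real_vector \<Rightarrow> 'l \<Rightarrow> 'l \<Rightarrow> real) \<Rightarrow> bool" where
  "symmetric_3_tensor S \<longleftrightarrow>
     (\<forall>Y Z. linear (\<lambda>X. S X Y Z)) \<and>
     (\<forall>X Y Z. S X Y Z = S Y X Z \<and> S X Y Z = S X Z Y)"

text \<open>\<open>(g, S)\<close> is the left-invariant SO(3) structure with adapted frame \<open>e\<close>.\<close>

definition so3_structure ::
    "(5 \<Rightarrow> 'l::real_vector) \<Rightarrow> ('l \<Rightarrow> 'l \<Rightarrow> real) \<Rightarrow> ('l \<Rightarrow> 'l \<Rightarrow> 'l \<Rightarrow> real) \<Rightarrow> bool" where
  "so3_structure e g S \<longleftrightarrow>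
     is_frame e \<and> g = frame_metric e \<and>
     symmetric_3_tensor S \<and> (\<forall>X. S X X X = so3_cubic e X)"


section \<open>Connections\<close>

definition cov_deriv_2 ::
    "('l::real_vector \<Rightarrow> 'l \<Rightarrow> 'l) \<Rightarrow> ('l \<Rightarrow> 'l \<Rightarrow> real) \<Rightarrow> 'l \<Rightarrow> 'l \<Rightarrow> 'l \<Rightarrow> real" where
  "cov_deriv_2 D g X Y Z = - g (D X Y) Z - g Y (D X Z)"

definition cov_deriv_3 ::
    "('l::real_vector \<Rightarrow> 'l \<Rightarrow> 'l) \<Rightarrow> ('l \<Rightarrow> 'l \<Rightarrow> 'l \<Rightarrow> real)
      \<Rightarrow> 'l \<Rightarrow> 'l \<Rightarrow> 'l \<Rightarrow> 'l \<Rightarrow> real" where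
  "cov_deriv_3 D S X Y Z W = - S (D X Y) Z W - S Y (D X Z) W - S Y Z (D X W)"

definition torsion ::
    "('l::real_vector \<Rightarrow> 'l \<Rightarrow> 'l) \<Rightarrow> ('l \<Rightarrow> 'l \<Rightarrow> real) \<Rightarrow> ('l \<Rightarrow> 'l \<Rightarrow> 'l)
      \<Rightarrow> 'l \<Rightarrow> 'l \<Rightarrow> 'l \<Rightarrow> real" where
  "torsion br g D X Y Z = g (D X Y - D Y X - br X Y) Z"

definition levi_civita ::
    "('l::real_vector \<Rightarrow> 'l \<Rightarrow> 'l) \<Rightarrow> ('l \<Rightarrow> 'l \<Rightarrow> real) \<Rightarrow> ('l \<Rightarrow> 'l \<Rightarrow> 'l) \<Rightarrow> bool" where
  "levi_civita br g D \<longleftrightarrow>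
     bilinear D \<and>
     (\<forall>X Y Z. cov_deriv_2 D g X Y Z = 0) \<and>
     (\<forall>X Y. D X Y - D Y X = br X Y)"

definition nearly_integrable ::
    "('l::real_vector \<Rightarrow> 'l \<Rightarrow> 'l) \<Rightarrow> ('l \<Rightarrow> 'l \<Rightarrow> real) \<Rightarrow> ('l \<Rightarrow> 'l \<Rightarrow> 'l \<Rightarrow> real) \<Rightarrow> bool" where
  "nearly_integrable br g S \<longleftrightarrow>
     (\<exists>D. levi_civita br g D \<and> (\<forall>X. cov_deriv_3 D S X X X X = 0))"

definition totally_skew :: "('l::real_vector \<Rightarrow> 'l \<Rightarrow> 'l \<Rightarrow> real) \<Rightarrow> bool" where
  "totally_skew \<omega> \<longleftrightarrow> (\<forall>X Y Z. \<omega> X Y Z = - \<omega> Y X Z \<and> \<omega> X Y Z = - \<omega> X Z Y)"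

definition characteristic_connection ::
    "('l::real_vector \<Rightarrow> 'l \<Rightarrow> 'l) \<Rightarrow> ('l \<Rightarrow> 'l \<Rightarrow> real) \<Rightarrow> ('l \<Rightarrow> 'l \<Rightarrow> 'l \<Rightarrow> real)
      \<Rightarrow> ('l \<Rightarrow> 'l \<Rightarrow> 'l) \<Rightarrow> bool" where
  "characteristic_connection br g S D \<longleftrightarrow>
     bilinear D \<and>
     (\<forall>X Y Z. cov_deriv_2 D g X Y Z = 0) \<and>
     (\<forall>X Y Z W. cov_deriv_3 D S X Y Z W = 0) \<and>
     totally_skew (torsion br g D)"


section \<open>Hodge star and exterior derivative\<close>

text \<open>The volume form is \<open>e\<^sup>1\<^sup>2\<^sup>3\<^sup>4\<^sup>5\<close>, and \<open>e\<close> is orthonormal for the metric of the structure.\<close>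

definition volume_form :: "(5 \<Rightarrow> 'l::real_vector) \<Rightarrow> 'l^5 \<Rightarrow> real" where
  "volume_form e X = det ((\<chi> i j. coframe e i (X $ j)) :: real^5^5)"

text \<open>Star of a three-form: \<open>(*\<omega>)(X,Y) = 1/3! \<Sum> \<omega>(e\<^sub>i,e\<^sub>j,e\<^sub>k) vol(e\<^sub>i,e\<^sub>j,e\<^sub>k,X,Y)\<close>,
  for instance \<open>*e\<^sup>1\<^sup>2\<^sup>3 = e\<^sup>4\<^sup>5\<close>.\<close>

definition hodge_star_3 ::
    "(5 \<Rightarrow> 'l::real_vector) \<Rightarrow> ('l \<Rightarrow> 'l \<Rightarrow> 'l \<Rightarrow> real) \<Rightarrow> 'l \<Rightarrow> 'l \<Rightarrow> real" where
  "hodge_star_3 e \<omega> X Y =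
     1/6 * (\<Sum>i\<in>UNIV. \<Sum>j\<in>UNIV. \<Sum>k\<in>UNIV.
              \<omega> (e i) (e j) (e k) * volume_form e (vector [e i, e j, e k, X, Y]))"

text \<open>Exterior derivative of a left-invariant two-form, with the convention
  \<open>d\<alpha>(X,Y) = - \<alpha>([X,Y])\<close> on one-forms.\<close>

definition ext_deriv_2 ::
    "('l::real_vector \<Rightarrow> 'l \<Rightarrow> 'l) \<Rightarrow> ('l \<Rightarrow> 'l \<Rightarrow> real) \<Rightarrow> 'l \<Rightarrow> 'l \<Rightarrow> 'l \<Rightarrow> real" where
  "ext_deriv_2 br \<beta> X Y Z = - \<beta> (br X Y) Z + \<beta> (br X Z) Y - \<beta> (br Y Z) X"

end

theory Submission
  imports Defs
begin

text \<open>
  The stabilizer of the cubic form is the irreducible \<open>\<ss>\<oo>(3) \<subset> \<ss>\<oo>(5)\<close>. It has one generator preserving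
  \<open>\<hh>\<close> and \<open>\<pp>\<close>, and two exchanging them; so the splitting condition leaves three coefficients of the
  characteristic connection along \<open>\<hh>\<close> and four along \<open>\<pp>\<close>. Together with the ten components of the torsion
  they determine the bracket, and the Jacobi identity becomes a system of quadratic equations in
  seventeen unknowns. The pair is symmetric iff the six torsion components with two indices in \<open>\<hh>\<close>
  and one in \<open>\<pp>\<close> vanish. If one of them does not vanish, the equations force the connection to be
  zero. A zero connection makes the bracket minus the torsion, for which the Jacobi identity means
  that the three-form is decomposable, so the algebra is \<open>\<ss>\<oo>(3) \<oplus> \<real>\<^sup>2\<close> or Abelian. In the symmetric case
  the remaining equations in eleven unknowns are solved by hand, and each family of solutions is identified.
\<close>

section \<open>Frames\<close>

text \<open>The bracket comes from the torsion formula: \<open>br X Y\<close> is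
  \<open>D X Y - D Y X\<close> minus the vector dual to \<open>T X Y\<close>. Call \<h> even and
  \<p> odd. The splitting condition says that \<open>D\<close> respects this grading, so the seven
  connection parameters and the torsion components with an even number of indices in \<p> are even,
  and exactly the six obstructions to symmetry are odd. Hence every component of the Jacobi identity
  is of one of two kinds: an even equation, quadratic in the even unknowns with at most products of
  two obstructions added, or an odd equation, linear in the obstructions with coefficients linear in
  the even unknowns. A nonzero obstruction vector therefore lies in the kernel of a large matrix,
  which is why it destroys the connection. Coclosedness rests on the same dichotomy. For a zero
  connection the star of the torsion is closed identically. For a symmetric pair the parity leaves
  four components of its derivative, and these vanish on each family of solutions.\<close>

lemma exhaust_5:
  fixes x :: 5
  shows "x = 1 \<or> x = 2 \<or> x = 3 \<or> x = 4 \<or> x = 5"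
proof (induct x)
  case (of_int z)
  then have "z = 0 \<or> z = 1 \<or> z = 2 \<or> z = 3 \<or> z = 4"
    by fastforce
  then show ?case
    by auto
qed

lemma forall_5: "(\<forall>i::5. P i) \<longleftrightarrow> P 1 \<and> P 2 \<and> P 3 \<and> P 4 \<and> P 5"
  by (metis exhaust_5)

lemma UNIV_5: "UNIV = {1, 2, 3, 4, 5::5}"
  using exhaust_5 by auto

lemma distinct_5:
  "(1::5) \<noteq> 2" "(1::5) \<noteq> 3" "(1::5) \<noteq> 4" "(1::5) \<noteq> 5" "(2::5) \<noteq> 3"
  "(2::5) \<noteq> 4" "(2::5) \<noteq> 5" "(3::5) \<noteq> 4" "(3::5) \<noteq> 5" "(4::5) \<noteq> 5"
  "(2::5) \<noteq> 1" "(3::5) \<noteq> 1" "(4::5) \<noteq> 1" "(5::5) \<noteq> 1" "(3::5) \<noteq> 2"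
  "(4::5) \<noteq> 2" "(5::5) \<noteq> 2" "(4::5) \<noteq> 3" "(5::5) \<noteq> 3" "(5::5) \<noteq> 4"
  by simp_all

lemma sum_5: "sum f (UNIV::5 set) = f 1 + f 2 + f 3 + f 4 + f 5"
  unfolding UNIV_5 by (simp add: ac_simps)

lemma vector_5:
  "(vector [a, b, c, d, x] :: ('a::zero)^5) $ 1 = a"
  "(vector [a, b, c, d, x] :: ('a::zero)^5) $ 2 = b"
  "(vector [a, b, c, d, x] :: ('a::zero)^5) $ 3 = c"
  "(vector [a, b, c, d, x] :: ('a::zero)^5) $ 4 = d"
  "(vector [a, b, c, d, x] :: ('a::zero)^5) $ 5 = x"
  unfolding vector_def by simp_all

text \<open>Serves as an induction rule for comparing two alternating brackets on a frame: only the
  ten increasing pairs require computation.\<close>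

lemma pairs_5:
  fixes P :: "5 \<Rightarrow> 5 \<Rightarrow> bool"
  assumes "\<And>i. P i i" and "\<And>i j. P i j \<Longrightarrow> P j i"
    and "P 1 2" "P 1 3" "P 1 4" "P 1 5" "P 2 3" "P 2 4" "P 2 5" "P 3 4" "P 3 5" "P 4 5"
  shows "P i j"
proof -
  have "\<forall>i. \<forall>j. P i j"
    unfolding forall_5 using assms by blast
  then show ?thesis
    by blast
qed

lemma
  assumes "is_frame e"
  shows coframe_add: "coframe e i (X + Y) = coframe e i X + coframe e i Y"
    and coframe_scale: "coframe e i (r *\<^sub>R X) = r * coframe e i X"
    and coframe_neg: "coframe e i (- X) = - coframe e i X"
    and coframe_diff: "coframe e i (X - Y) = coframe e i X - coframe e i Y"
    and coframe_zero: "coframe e i 0 = 0"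
    and coframe_basis: "coframe e i (e j) = (if i = j then 1 else 0)"
proof -
  have ind: "independent (range e)" and sp: "\<And>X. X \<in> span (range e)" and inj: "inj e"
    using assms by (auto simp: is_frame_def)
  show "coframe e i (X + Y) = coframe e i X + coframe e i Y"
    by (simp add: coframe_def representation_add[OF ind sp sp])
  show "coframe e i (r *\<^sub>R X) = r * coframe e i X"
    by (simp add: coframe_def representation_scale[OF ind sp])
  show "coframe e i (- X) = - coframe e i X"
    by (simp add: coframe_def representation_neg[OF ind sp])
  show "coframe e i (X - Y) = coframe e i X - coframe e i Y"
    by (simp add: coframe_def representation_diff[OF ind sp sp])
  show "coframe e i 0 = 0"
    by (simp add: coframe_def representation_zero)
  show "coframe e i (e j) = (if i = j then 1 else 0)"
    using inj by (simp add: coframe_def representation_basis[OF ind] inj_eq)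
qed

lemmas coframe_simps =
  coframe_add coframe_scale coframe_neg coframe_diff coframe_zero coframe_basis

lemma linear_coframe: "is_frame e \<Longrightarrow> linear (coframe e i)"
  by (intro linearI) (simp_all add: coframe_simps)

lemma coframe_expansion:
  assumes "is_frame e"
  shows "X = (\<Sum>i\<in>UNIV. coframe e i X *\<^sub>R e i)"
proof -
  have "(\<Sum>b\<in>range e. representation (range e) X b *\<^sub>R b) = X"
    using assms by (intro sum_representation_eq) (auto simp: is_frame_def)
  then show ?thesis
    using assms by (simp add: is_frame_def sum.reindex coframe_def)
qed

lemma frame_eqI:
  assumes "is_frame e" and "\<And>i. coframe e i X = coframe e i Y"
  shows "X = Y"
  using coframe_expansion[OF assms(1), of X] coframe_expansion[OF assms(1), of Y] assms(2) by simp

lemma coframe_sum: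
  assumes "is_frame e"
  shows "coframe e k (\<Sum>i\<in>UNIV. c i *\<^sub>R e i) = c k"
proof -
  have "coframe e k (\<Sum>i\<in>UNIV. c i *\<^sub>R e i) = (\<Sum>i\<in>UNIV. coframe e k (c i *\<^sub>R e i))"
    by (rule linear_sum[OF linear_coframe[OF assms]])
  then show ?thesis
    by (simp add: coframe_simps[OF assms] if_distrib[of "\<lambda>t. _ * t"] cong: if_cong)
qed

text \<open>Five vectors spanning a five-dimensional space form a basis, by the exchange lemma.\<close>

lemma is_frame_spanI:
  assumes "is_frame e" and "\<And>i. e i \<in> span (range v)"
  shows "is_frame v"
proof -
  have ind: "independent (range e)" and sp: "span (range e) = UNIV" and inj: "inj e"
    using assms by (auto simp: is_frame_def)
  have card_e: "card (range e) = 5"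
    using inj by (simp add: card_image)
  have "range e \<subseteq> span (range v)"
    using assms(2) by auto
  then have spv: "span (range v) = UNIV"
    using sp span_mono[of "range e" "span (range v)"] by (simp add: span_span top.extremum_uniqueI)
  have bound: "5 \<le> card B" if "finite B" "span B = UNIV" for B :: "'a set"
    using independent_span_bound[OF that(1) ind] that card_e by auto
  have "card (range v) \<le> 5"
    using card_image_le[of UNIV v] by simp
  moreover have "5 \<le> card (range v)"
    using bound[OF _ spv] by simp
  ultimately have card_v: "card (range v) = 5"
    by simp
  have "inj v"
    by (rule eq_card_imp_inj_on) (use card_v in simp_all)
  moreover have "independent (range v)"
  proof
    assume "dependent (range v)"
    then obtain a where a: "a \<in> range v" "a \<in> span (range v - {a})"
      by (auto simp: dependent_def)
    then have "span (range v - {a}) = UNIV"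
      using spv span_redundant[OF a(2)] by (metis insert_Diff)
    then have "5 \<le> card (range v - {a})"
      by (intro bound) auto
    then show False
      using a(1) card_v by (simp add: card_Diff_singleton)
  qed
  ultimately show ?thesis
    using spv by (simp add: is_frame_def)
qed

lemma is_frame_permute:
  assumes "is_frame e" and "bij p"
  shows "is_frame (e \<circ> p)"
proof -
  have "range (e \<circ> p) = range e"
    using assms(2) by (metis bij_is_surj image_comp)
  then show ?thesis
    using assms by (auto simp: is_frame_def intro: inj_compose bij_is_inj)
qed

section \<open>Brackets in a frame\<close>

lemma lie_algebra_bilinear: "lie_algebra br \<Longrightarrow> bilinear br"
  by (simp add: lie_algebra_def)

lemma lie_algebra_self: "lie_algebra br \<Longrightarrow> br X X = 0"
  by (simp add: lie_algebra_def)

lemma alternating_imp_skew: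
  assumes "bilinear b" and "\<And>X. b X X = 0"
  shows "b X Y = - b Y X"
proof -
  have "b (X + Y) (X + Y) = 0"
    by (rule assms(2))
  then have "b X Y + b Y X = 0"
    using assms(2)[of X] assms(2)[of Y]
    by (simp add: bilinear_ladd[OF assms(1)] bilinear_radd[OF assms(1)] add.commute)
  then show ?thesis
    by (simp add: eq_neg_iff_add_eq_0)
qed

lemma lie_algebra_skew: "lie_algebra br \<Longrightarrow> br X Y = - br Y X"
  by (rule alternating_imp_skew) (simp_all add: lie_algebra_def)

lemma bilinear_expansion:
  assumes "is_frame e" and "bilinear b"
  shows "b X Y = (\<Sum>i\<in>UNIV. \<Sum>j\<in>UNIV. (coframe e i X * coframe e j Y) *\<^sub>R b (e i) (e j))"
proof -
  have lin: "linear (\<lambda>x. b x Z)" "linear (b Z)" for Z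
    using assms(2) by (auto simp: bilinear_def)
  have "b X Y = b (\<Sum>i\<in>UNIV. coframe e i X *\<^sub>R e i) Y"
    using coframe_expansion[OF assms(1), of X] by simp
  also have "\<dots> = (\<Sum>i\<in>UNIV. coframe e i X *\<^sub>R b (e i) Y)"
    by (simp add: linear_sum[OF lin(1)] linear_scale[OF lin(1)])
  also have "\<dots> = (\<Sum>i\<in>UNIV. coframe e i X *\<^sub>R b (e i) (\<Sum>j\<in>UNIV. coframe e j Y *\<^sub>R e j))"
    using coframe_expansion[OF assms(1), of Y] by simp
  also have "\<dots> = (\<Sum>i\<in>UNIV. coframe e i X *\<^sub>R (\<Sum>j\<in>UNIV. coframe e j Y *\<^sub>R b (e i) (e j)))"
    by (simp add: linear_sum[OF lin(2)] linear_scale[OF lin(2)])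
  finally show ?thesis
    by (simp add: scaleR_right.sum)
qed

text \<open>Since \<open>W\<close> may be a proper subspace of its type, the target basis is a
  family \<open>w\<close> with explicit independence and range, not a frame. By bilinearity the
  structure constants of \<open>v\<close> and \<open>w\<close> are all that must agree.\<close>

lemma lie_isomorphic_frameI:
  fixes br :: "'l::real_vector \<Rightarrow> 'l \<Rightarrow> 'l" and w :: "5 \<Rightarrow> 'm::real_vector"
  assumes v: "is_frame v" and br: "lie_algebra br"
    and brW: "bilinear brW"
    and ind: "\<And>c. (\<Sum>i\<in>UNIV. c i *\<^sub>R w i) = 0 \<Longrightarrow> \<forall>i. c i = 0"
    and W: "W = range (\<lambda>c. \<Sum>i\<in>UNIV. c i *\<^sub>R w i)"
    and eq: "\<And>i j. brW (w i) (w j) = (\<Sum>k\<in>UNIV. coframe v k (br (v i) (v j)) *\<^sub>R w k)"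
  shows "lie_isomorphic br W brW"
proof -
  define f where "f X = (\<Sum>i\<in>UNIV. coframe v i X *\<^sub>R w i)" for X
  have lin: "linear f"
    by (intro linearI)
      (simp_all add: f_def coframe_simps[OF v] scaleR_left_distrib sum.distrib scaleR_right.sum)
  have "inj f"
    unfolding linear_injective_0[OF lin]
  proof (intro allI impI)
    fix X
    assume "f X = 0"
    then have "coframe v i X = 0" for i
      using ind[of "\<lambda>i. coframe v i X"] by (simp add: f_def)
    then show "X = 0"
      by (intro frame_eqI[OF v]) (simp add: coframe_zero[OF v])
  qed
  moreover have "range f = W"
  proof -
    have "(\<Sum>i\<in>UNIV. c i *\<^sub>R w i) = f (\<Sum>i\<in>UNIV. c i *\<^sub>R v i)" for c
      by (simp add: f_def coframe_sum[OF v])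
    then show ?thesis
      unfolding W f_def by auto
  qed
  moreover have "f (br X Y) = brW (f X) (f Y)" for X Y
  proof -
    have fv: "f (v i) = w i" for i
      by (simp add: f_def coframe_basis[OF v] if_distrib[of "\<lambda>t. t *\<^sub>R _"] cong: if_cong)
    have "f (br X Y) = (\<Sum>i\<in>UNIV. \<Sum>j\<in>UNIV. (coframe v i X * coframe v j Y) *\<^sub>R f (br (v i) (v j)))"
      by (subst bilinear_expansion[OF v lie_algebra_bilinear[OF br]])
        (simp add: linear_sum[OF lin] linear_scale[OF lin])
    also have "\<dots> = (\<Sum>i\<in>UNIV. \<Sum>j\<in>UNIV. (coframe v i X * coframe v j Y) *\<^sub>R brW (f (v i)) (f (v j)))"
      by (simp add: fv eq) (simp add: f_def)
    also have "\<dots> = brW (f X) (f Y)"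
    proof -
      have "bilinear (\<lambda>X Y. brW (f X) (f Y))"
        using brW lin by (auto simp: bilinear_def intro: linear_compose[unfolded o_def])
      then show ?thesis
        by (rule bilinear_expansion[OF v, symmetric])
    qed
    finally show ?thesis .
  qed
  ultimately show ?thesis
    using lin by (auto simp: lie_isomorphic_def bij_betw_def)
qed

section \<open>Solvable Lie algebras\<close>

lemma lie_algebra_linear:
  assumes "lie_algebra br"
  shows "linear (br X)" and "linear (\<lambda>X. br X Y)"
  using assms by (simp_all add: lie_algebra_def bilinear_def)

lemma bilinear_span:
  assumes b: "bilinear b" and AB: "\<And>X Y. X \<in> A \<Longrightarrow> Y \<in> B \<Longrightarrow> b X Y \<in> span C"
    and "X \<in> span A" "Y \<in> span B"
  shows "b X Y \<in> span C"
proof -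
  have lin: "linear (b X)" "linear (\<lambda>X. b X Y)" for X Y
    using b by (simp_all add: bilinear_def)
  have "b X Y \<in> span C" if "X \<in> A" for X
    using linear_span_image[OF lin(1), of X B] AB[OF that] assms(4)
      span_minimal[of "b X ` B" "span C"] by (auto simp: subspace_span)
  then show ?thesis
    using linear_span_image[OF lin(2), of Y A] assms(3)
      span_minimal[of "(\<lambda>X. b X Y) ` A" "span C"] by (auto simp: subspace_span)
qed

lemma derived_algebra_span:
  assumes "lie_algebra br" and "U \<subseteq> span A"
    and "\<And>X Y. X \<in> A \<Longrightarrow> Y \<in> A \<Longrightarrow> br X Y \<in> span B"
  shows "derived_algebra br U \<subseteq> span B"
  unfolding derived_algebra_def
proof (rule span_minimal)
  show "{br X Y |X Y. X \<in> U \<and> Y \<in> U} \<subseteq> span B"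
    using assms(2) bilinear_span[OF lie_algebra_bilinear[OF assms(1)], of A A B] assms(3) by blast
qed (rule subspace_span)

text \<open>The spans of \<open>A\<close>, \<open>B\<close>, \<open>C\<close> bound the first three
  terms of the derived series, and the last hypothesis kills the fourth. A shorter series is covered
  by taking the later sets empty.\<close>

lemma lie_solvableI:
  assumes br: "lie_algebra br" and f: "is_frame f"
    and "\<And>i j. br (f i) (f j) \<in> span A"
    and "\<And>X Y. X \<in> A \<Longrightarrow> Y \<in> A \<Longrightarrow> br X Y \<in> span B"
    and "\<And>X Y. X \<in> B \<Longrightarrow> Y \<in> B \<Longrightarrow> br X Y \<in> span C"
    and "\<And>X Y. X \<in> C \<Longrightarrow> Y \<in> C \<Longrightarrow> br X Y = 0"
  shows "lie_solvable br"
proof -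
  let ?D = "derived_algebra br"
  have "?D UNIV \<subseteq> span A"
    by (rule derived_algebra_span[OF br, of _ "range f"]) (use f assms(3) in \<open>auto simp: is_frame_def\<close>)
  then have "?D (?D UNIV) \<subseteq> span B"
    by (rule derived_algebra_span[OF br]) (use assms(4) in auto)
  then have "?D (?D (?D UNIV)) \<subseteq> span C"
    by (rule derived_algebra_span[OF br]) (use assms(5) in auto)
  then have "?D (?D (?D (?D UNIV))) \<subseteq> span {}"
    by (rule derived_algebra_span[OF br]) (use assms(6) in auto)
  moreover have "0 \<in> ?D U" for U
    by (simp add: derived_algebra_def span_zero)
  ultimately have "(?D ^^ 4) UNIV = {0}"
    by (auto simp: numeral_eq_Suc)
  then show ?thesis
    unfolding lie_solvable_def ..
qed

section \<open>Recognising the model algebras\<close>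

lemma bilinear_sum_bracket:
  assumes "bilinear b1" and "bilinear b2"
  shows "bilinear (sum_bracket b1 b2)"
  using assms by (auto simp: bilinear_def sum_bracket_def linear_iff)

lemma bilinear_commutator: "bilinear commutator"
  by (auto simp: bilinear_def commutator_def linear_iff algebra_simps vec_eq_iff
      matrix_matrix_mult_def sum.distrib sum_distrib_left)

text \<open>The case \<open>s = 1\<close> is \<open>\<ss>\<oo>(3) \<oplus> \<ss>\<^sub>2\<close> and the case \<open>s = 0\<close> is \<open>\<ss>\<oo>(3) \<oplus> \<real>\<^sup>2\<close>.\<close>

lemma lie_isomorphic_so3_plus:
  fixes br :: "'l::real_vector \<Rightarrow> 'l \<Rightarrow> 'l"
  assumes br: "lie_algebra br" and f: "is_frame f"
    and span: "\<And>i. f i \<in> span {x, y, z, u, v}"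
    and pos: "k1 * k2 > 0" "k2 * k3 > 0"
    and so3: "br x y = k3 *\<^sub>R z" "br y z = k1 *\<^sub>R x" "br z x = k2 *\<^sub>R y"
    and zero: "br x u = 0" "br y u = 0" "br z u = 0" "br x v = 0" "br y v = 0" "br z v = 0"
    and uv: "br u v = - s *\<^sub>R v"
  shows "lie_isomorphic br (so3 \<times> UNIV)
    (sum_bracket commutator (\<lambda>X Y. - vector [0, s * wedge 1 2 X Y]) :: (real^3^3) \<times> (real^2) \<Rightarrow> _)"
proof -
  \<comment> \<open>Scaling \<open>x\<close>, \<open>y\<close>, \<open>z\<close> by
    \<open>s1\<close>, \<open>s2\<close>, \<open>s1 * s2 * k3\<close> makes all three structure
    constants equal to 1. The square roots are real because the \<open>k\<close>s have a common
    sign; a mixed sign would give the other real form \<ss>\<ll>(2).\<close>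
  define s1 where "s1 = 1 / sqrt (k2 * k3)"
  define s2 where "s2 = 1 / sqrt (k1 * k3)"
  have pos': "k1 * k3 > 0"
    using pos by (auto simp: zero_less_mult_iff)
  have s1: "s1 * s1 * (k2 * k3) = 1" and s2: "s2 * s2 * (k1 * k3) = 1" and nz: "s1 \<noteq> 0" "s2 \<noteq> 0" "k3 \<noteq> 0"
    using pos pos' by (auto simp: s1_def s2_def field_simps)
  define w :: "5 \<Rightarrow> (real^3^3) \<times> (real^2)" where
    "w = ($) (vector [(vector [vector [0, 0, 0], vector [0, 0, -1], vector [0, 1, 0]], 0),
      (vector [vector [0, 0, 1], vector [0, 0, 0], vector [-1, 0, 0]], 0),
      (vector [vector [0, -1, 0], vector [1, 0, 0], vector [0, 0, 0]], 0),
      (0, vector [1, 0]), (0, vector [0, 1])])"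
  define g where "g = ($) (vector [s1 *\<^sub>R x, s2 *\<^sub>R y, (s1 * s2 * k3) *\<^sub>R z, u, v] :: 'l^5)"
  have g: "g 1 = s1 *\<^sub>R x" "g 2 = s2 *\<^sub>R y" "g 3 = (s1 * s2 * k3) *\<^sub>R z" "g 4 = u" "g 5 = v"
    by (simp_all only: g_def vector_5)
  have "{x, y, z, u, v} \<subseteq> span (range g)"
  proof -
    have "x = (1 / s1) *\<^sub>R g 1" "y = (1 / s2) *\<^sub>R g 2" "z = (1 / (s1 * s2 * k3)) *\<^sub>R g 3" "u = g 4" "v = g 5"
      using nz by (simp_all add: g)
    then show ?thesis
      by (metis (no_types, lifting) insert_subset empty_subsetI rangeI span_base span_scale)
  qed
  then have "f i \<in> span (range g)" for i
    using span[of i] span_mono[of "{x, y, z, u, v}" "span (range g)"] by (auto simp: span_span)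
  then have frame: "is_frame g"
    by (rule is_frame_spanI[OF f])
  let ?b = "sum_bracket commutator (\<lambda>X Y. - vector [0, s * wedge 1 2 X Y]) :: (real^3^3) \<times> (real^2) \<Rightarrow> _"
  have w: "w 1 = (vector [vector [0, 0, 0], vector [0, 0, -1], vector [0, 1, 0]], 0)"
    "w 2 = (vector [vector [0, 0, 1], vector [0, 0, 0], vector [-1, 0, 0]], 0)"
    "w 3 = (vector [vector [0, -1, 0], vector [1, 0, 0], vector [0, 0, 0]], 0)"
    "w 4 = (0, vector [1, 0])" "w 5 = (0, vector [0, 1])"
    by (simp_all only: w_def vector_5)
  have comb: "(\<Sum>i\<in>UNIV. c i *\<^sub>R w i) =
    (vector [vector [0, - c 3, c 2], vector [c 3, 0, - c 1], vector [- c 2, c 1, 0]], vector [c 4, c 5])" for c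
    by (simp add: sum_5 w prod_eq_iff vec_eq_iff forall_3 forall_2)
  show ?thesis
  proof (rule lie_isomorphic_frameI[OF frame br, of _ w])
    show bil: "bilinear ?b"
      by (intro bilinear_sum_bracket bilinear_commutator)
        (auto simp: bilinear_def linear_iff wedge_def vec_eq_iff forall_2 algebra_simps)
    show "\<forall>i. c i = 0" if "(\<Sum>i\<in>UNIV. c i *\<^sub>R w i) = 0" for c
      using that unfolding comb by (simp add: forall_5 prod_eq_iff vec_eq_iff forall_3 forall_2)
    show "so3 \<times> UNIV = range (\<lambda>c. \<Sum>i\<in>UNIV. c i *\<^sub>R w i)"
    proof (intro subset_antisym subsetI)
      fix X :: "(real^3^3) \<times> (real^2)"
      assume "X \<in> so3 \<times> UNIV"
      then obtain M p where X: "X = (M, p)" and M: "M $ i $ j = - M $ j $ i" for i j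
        by (auto simp: so3_def transpose_def vec_eq_iff)
      have "X = (\<Sum>i\<in>UNIV. (($) (vector [M $ 3 $ 2, M $ 1 $ 3, M $ 2 $ 1, p $ 1, p $ 2])) i *\<^sub>R w i)"
        unfolding comb vector_5 X
        using M[of 1 1] M[of 2 2] M[of 3 3] M[of 1 2] M[of 2 3] M[of 3 1]
        by (simp add: vec_eq_iff forall_3 forall_2)
      then show "X \<in> range (\<lambda>c. \<Sum>i\<in>UNIV. c i *\<^sub>R w i)"
        by blast
    next
      fix X
      assume "X \<in> range (\<lambda>c. \<Sum>i\<in>UNIV. c i *\<^sub>R w i)"
      then show "X \<in> so3 \<times> UNIV"
        unfolding comb by (auto simp: so3_def transpose_def vec_eq_iff forall_3)
    qed
    have b0: "?b X X = 0" for X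
      by (simp add: sum_bracket_def commutator_def wedge_def vec_eq_iff forall_2 prod_eq_iff)
    show "?b (w i) (w j) = (\<Sum>k\<in>UNIV. coframe g k (br (g i) (g j)) *\<^sub>R w k)" for i j
    proof (induction rule: pairs_5)
      show "?b (w i) (w i) = (\<Sum>k\<in>UNIV. coframe g k (br (g i) (g i)) *\<^sub>R w k)" for i
        by (simp add: b0 lie_algebra_self[OF br] coframe_zero[OF frame])
      show "?b (w j) (w i) = (\<Sum>k\<in>UNIV. coframe g k (br (g j) (g i)) *\<^sub>R w k)"
        if "?b (w i) (w j) = (\<Sum>k\<in>UNIV. coframe g k (br (g i) (g j)) *\<^sub>R w k)" for i j
        using that alternating_imp_skew[OF bil b0, of "w j" "w i"] lie_algebra_skew[OF br, of "g j" "g i"]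
        by (simp add: coframe_neg[OF frame] sum_negf)
      note lin = linear_scale[OF lie_algebra_linear(1)[OF br]] linear_scale[OF lie_algebra_linear(2)[OF br]]
      have zx: "br x z = - (k2 *\<^sub>R y)"
        using lie_algebra_skew[OF br, of x z] so3(3) by simp
      have "br (g 1) (g 2) = g 3" "br (g 2) (g 3) = g 1" "br (g 1) (g 3) = - g 2"
        using s1 s2 by (simp_all add: g lin so3 zx mult_ac)
      moreover have "br (g 1) (g 4) = 0" "br (g 2) (g 4) = 0" "br (g 3) (g 4) = 0"
        "br (g 1) (g 5) = 0" "br (g 2) (g 5) = 0" "br (g 3) (g 5) = 0"
        by (simp_all add: g lin zero)
      moreover have "br (g 4) (g 5) = - s *\<^sub>R g 5"
        by (simp add: g uv)
      ultimately show "?b (w 1) (w 2) = (\<Sum>k\<in>UNIV. coframe g k (br (g 1) (g 2)) *\<^sub>R w k)"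
        "?b (w 1) (w 3) = (\<Sum>k\<in>UNIV. coframe g k (br (g 1) (g 3)) *\<^sub>R w k)"
        "?b (w 1) (w 4) = (\<Sum>k\<in>UNIV. coframe g k (br (g 1) (g 4)) *\<^sub>R w k)"
        "?b (w 1) (w 5) = (\<Sum>k\<in>UNIV. coframe g k (br (g 1) (g 5)) *\<^sub>R w k)"
        "?b (w 2) (w 3) = (\<Sum>k\<in>UNIV. coframe g k (br (g 2) (g 3)) *\<^sub>R w k)"
        "?b (w 2) (w 4) = (\<Sum>k\<in>UNIV. coframe g k (br (g 2) (g 4)) *\<^sub>R w k)"
        "?b (w 2) (w 5) = (\<Sum>k\<in>UNIV. coframe g k (br (g 2) (g 5)) *\<^sub>R w k)"
        "?b (w 3) (w 4) = (\<Sum>k\<in>UNIV. coframe g k (br (g 3) (g 4)) *\<^sub>R w k)"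
        "?b (w 3) (w 5) = (\<Sum>k\<in>UNIV. coframe g k (br (g 3) (g 5)) *\<^sub>R w k)"
        "?b (w 4) (w 5) = (\<Sum>k\<in>UNIV. coframe g k (br (g 4) (g 5)) *\<^sub>R w k)"
        by (simp_all add: coframe_simps[OF frame] distinct_5 sum_5 w sum_bracket_def commutator_def
            wedge_def vec_eq_iff forall_2 forall_3 prod_eq_iff matrix_matrix_mult_def sum_3)
    qed
  qed
qed

text \<open>The model is \<ss>\<ll>(2) acting on its standard representation: indices 1, 2, 4 span
  \<ss>\<ll>(2) with \<open>g 2\<close> semisimple, and 3, 5 span the Abelian ideal, on which
  \<open>g 2\<close> has eigenvalues 1 and -1.\<close>

lemma iso_l2I:
  fixes br :: "'l::real_vector \<Rightarrow> 'l \<Rightarrow> 'l"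
  assumes br: "lie_algebra br" and g: "is_frame g"
    and "br (g 1) (g 2) = - 2 *\<^sub>R g 1" "br (g 1) (g 3) = 0" "br (g 1) (g 4) = - g 2"
      "br (g 1) (g 5) = - g 3" "br (g 2) (g 3) = g 3" "br (g 2) (g 4) = - 2 *\<^sub>R g 4"
      "br (g 2) (g 5) = - g 5" "br (g 3) (g 4) = - g 5" "br (g 3) (g 5) = 0" "br (g 4) (g 5) = 0"
  shows "iso_l2 br"
  unfolding iso_l2_def
proof (rule lie_isomorphic_frameI[OF g br, of _ "\<lambda>i. axis i 1"])
  show bil: "bilinear l2_bracket"
    by (auto simp: bilinear_def linear_iff l2_bracket_def wedge_def vec_eq_iff forall_5 vector_5 algebra_simps)
  have comb: "(\<Sum>i\<in>UNIV. c i *\<^sub>R (axis i 1 :: real^5)) = (\<chi> i. c i)" for c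
    by (simp add: vec_eq_iff axis_def if_distrib[of "\<lambda>t. _ * t"] cong: if_cong)
  show "\<forall>i. c i = 0" if "(\<Sum>i\<in>UNIV. c i *\<^sub>R (axis i 1 :: real^5)) = 0" for c
    using that unfolding comb by (simp add: vec_eq_iff)
  show "UNIV = range (\<lambda>c. \<Sum>i\<in>UNIV. c i *\<^sub>R (axis i 1 :: real^5))"
    unfolding comb by (auto intro: range_eqI[of _ _ "($) _"] simp: vec_eq_iff)
  have b0: "l2_bracket X X = 0" for X
    by (simp add: l2_bracket_def wedge_def vec_eq_iff forall_5 vector_5)
  show "l2_bracket (axis i 1) (axis j 1) = (\<Sum>k\<in>UNIV. coframe g k (br (g i) (g j)) *\<^sub>R axis k 1)" for i j
    unfolding comb
  proof (induction rule: pairs_5)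
    show "l2_bracket (axis i 1) (axis i 1) = (\<chi> k. coframe g k (br (g i) (g i)))" for i
      by (simp add: b0 lie_algebra_self[OF br] coframe_zero[OF g] vec_eq_iff)
    show "l2_bracket (axis j 1) (axis i 1) = (\<chi> k. coframe g k (br (g j) (g i)))"
      if "l2_bracket (axis i 1) (axis j 1) = (\<chi> k. coframe g k (br (g i) (g j)))" for i j
      using that alternating_imp_skew[OF bil b0, of "axis j 1" "axis i 1"] lie_algebra_skew[OF br, of "g j" "g i"]
      by (simp add: coframe_neg[OF g] vec_eq_iff)
  qed (simp_all add: assms(3-) coframe_simps[OF g] distinct_5 l2_bracket_def wedge_def vec_eq_iff forall_5
      vector_5 axis_def)
qed

section \<open>Totally skew structure tensors and decomposable three-forms\<close>

lemma bilinear_eq_on_frame: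
  assumes "is_frame e" and "bilinear b" and "bilinear b'" and "\<And>i j. b (e i) (e j) = b' (e i) (e j)"
  shows "b X Y = b' X Y"
  by (subst (1 2) bilinear_expansion[OF assms(1)]) (simp_all add: assms)

lemma bilinear_simps:
  assumes "bilinear b"
  shows "b (X + Y) Z = b X Z + b Y Z" "b X (Y + Z) = b X Y + b X Z"
    "b (r *\<^sub>R X) Y = r *\<^sub>R b X Y" "b X (r *\<^sub>R Y) = r *\<^sub>R b X Y"
    "b (- X) Y = - b X Y" "b X (- Y) = - b X Y"
    "b (X - Y) Z = b X Z - b Y Z" "b X (Y - Z) = b X Y - b X Z"
    "b 0 Y = 0" "b X 0 = 0"
  by (simp_all add: bilinear_ladd[OF assms] bilinear_radd[OF assms] bilinear_lmul[OF assms]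
      bilinear_rmul[OF assms] bilinear_lneg[OF assms] bilinear_rneg[OF assms] bilinear_lsub[OF assms]
      bilinear_rsub[OF assms] bilinear_lzero[OF assms] bilinear_rzero[OF assms])

text \<open>The bracket below is that of the three-form \<open>- l \<phi>\<^sub>1 \<and> \<phi>\<^sub>2 \<and> \<phi>\<^sub>3\<close> with respect to an orthonormal
  frame, where \<open>\<phi>\<^sub>i = e\<^sup>i + m\<^sub>i e\<^sup>4 + n\<^sub>i e\<^sup>5\<close> is dual to \<open>F\<^sub>i\<close>. The image is spanned by the \<open>F\<^sub>i\<close>, the centre by
  \<open>e\<^sub>4 - \<Sum> m\<^sub>i e\<^sub>i\<close> and \<open>e\<^sub>5 - \<Sum> n\<^sub>i e\<^sub>i\<close>, and an orthogonalization of the \<open>F\<^sub>i\<close> is, up to scaling,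
  the standard basis of \<open>\<ss>\<oo>(3)\<close>.\<close>

lemma iso_so3_plus_R2_decomposable:
  fixes e :: "5 \<Rightarrow> 'l::real_vector"
  assumes br: "lie_algebra br" and e: "is_frame e" and "l \<noteq> 0"
    and F: "F1 = e 1 + m1 *\<^sub>R e 4 + n1 *\<^sub>R e 5" "F2 = e 2 + m2 *\<^sub>R e 4 + n2 *\<^sub>R e 5"
      "F3 = e 3 + m3 *\<^sub>R e 4 + n3 *\<^sub>R e 5"
    and table: "br (e 1) (e 2) = l *\<^sub>R F3" "br (e 1) (e 3) = - l *\<^sub>R F2" "br (e 2) (e 3) = l *\<^sub>R F1"
      "br (e 1) (e 4) = l *\<^sub>R (m2 *\<^sub>R F3 - m3 *\<^sub>R F2)" "br (e 1) (e 5) = l *\<^sub>R (n2 *\<^sub>R F3 - n3 *\<^sub>R F2)"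
      "br (e 2) (e 4) = l *\<^sub>R (m3 *\<^sub>R F1 - m1 *\<^sub>R F3)" "br (e 2) (e 5) = l *\<^sub>R (n3 *\<^sub>R F1 - n1 *\<^sub>R F3)"
      "br (e 3) (e 4) = l *\<^sub>R (m1 *\<^sub>R F2 - m2 *\<^sub>R F1)" "br (e 3) (e 5) = l *\<^sub>R (n1 *\<^sub>R F2 - n2 *\<^sub>R F1)"
      "br (e 4) (e 5) = l *\<^sub>R ((m2 * n3 - m3 * n2) *\<^sub>R F1 + (m3 * n1 - m1 * n3) *\<^sub>R F2
        + (m1 * n2 - m2 * n1) *\<^sub>R F3)"
  shows "iso_so3_plus_R2 br"
proof -
  define p1 where "p1 X = coframe e 1 X + m1 * coframe e 4 X + n1 * coframe e 5 X" for X
  define p2 where "p2 X = coframe e 2 X + m2 * coframe e 4 X + n2 * coframe e 5 X" for X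
  define p3 where "p3 X = coframe e 3 X + m3 * coframe e 4 X + n3 * coframe e 5 X" for X
  note p_def = p1_def p2_def p3_def
  note co = coframe_simps[OF e] distinct_5
  have p: "p1 (e 1) = 1" "p1 (e 2) = 0" "p1 (e 3) = 0" "p1 (e 4) = m1" "p1 (e 5) = n1"
    "p2 (e 1) = 0" "p2 (e 2) = 1" "p2 (e 3) = 0" "p2 (e 4) = m2" "p2 (e 5) = n2"
    "p3 (e 1) = 0" "p3 (e 2) = 0" "p3 (e 3) = 1" "p3 (e 4) = m3" "p3 (e 5) = n3"
    by (simp_all add: p_def co)
  have lin: "linear p1" "linear p2" "linear p3"
    by (auto simp: linear_iff p_def co algebra_simps)
  define b where "b X Y = l *\<^sub>R ((p2 X * p3 Y - p3 X * p2 Y) *\<^sub>R F1 + (p3 X * p1 Y - p1 X * p3 Y) *\<^sub>R F2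
        + (p1 X * p2 Y - p2 X * p1 Y) *\<^sub>R F3)" for X Y
  have bil: "bilinear b"
    using lin by (auto simp: bilinear_def linear_iff b_def algebra_simps)
  have "b X X = 0" for X
    by (simp add: b_def)
  note b_skew = alternating_imp_skew[OF bil this]
  have br_eq: "br X Y = b X Y" for X Y
  proof (rule bilinear_eq_on_frame[OF e lie_algebra_bilinear[OF br] bil])
    fix i j
    show "br (e i) (e j) = b (e i) (e j)"
    proof (induction rule: pairs_5)
      show "br (e j) (e i) = b (e j) (e i)" if "br (e i) (e j) = b (e i) (e j)" for i j
        using that lie_algebra_skew[OF br, of "e j" "e i"] b_skew[of "e j" "e i"] by simp
    qed (simp_all add: table b_def p lie_algebra_self[OF br] algebra_simps)
  qed
  \<comment> \<open>\<open>G\<close> is the Gram matrix of the \<open>F\<close>s, and its entries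
    are also the values of the forms \<open>p1\<close>, \<open>p2\<close>, \<open>p3\<close> on
    them.\<close>
  define G11 where "G11 = 1 + m1 * m1 + n1 * n1"
  define G12 where "G12 = m1 * m2 + n1 * n2"
  define G13 where "G13 = m1 * m3 + n1 * n3"
  define G22 where "G22 = 1 + m2 * m2 + n2 * n2"
  define G23 where "G23 = m2 * m3 + n2 * n3"
  define G33 where "G33 = 1 + m3 * m3 + n3 * n3"
  note G = G11_def G12_def G13_def G22_def G23_def G33_def
  define M where "M = G11 * G22 - G12 * G12"
  \<comment> \<open>The coefficients of \<open>H\<close> are the cofactors of the third column of
    \<open>G\<close>. Hence \<open>p1\<close> and \<open>p2\<close> vanish on \<open>H\<close> and
    \<open>p3\<close> takes the value of the Gram determinant \<open>Det\<close> there. Likewise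
    \<open>y\<close> is the Gram-Schmidt step that removes \<open>F1\<close> from
    \<open>F2\<close>.\<close>
  define H where "H = (G12 * G23 - G13 * G22) *\<^sub>R F1 + (G13 * G12 - G11 * G23) *\<^sub>R F2 + M *\<^sub>R F3"
  define Det where "Det = G13 * (G12 * G23 - G13 * G22) + G23 * (G13 * G12 - G11 * G23) + G33 * M"
  define y where "y = G11 *\<^sub>R F2 - G12 *\<^sub>R F1"
  have pF: "p1 F1 = G11" "p2 F1 = G12" "p3 F1 = G13" "p1 F2 = G12" "p2 F2 = G22" "p3 F2 = G23"
    "p1 F3 = G13" "p2 F3 = G23" "p3 F3 = G33"
    by (simp_all add: F p_def co G)
  note pl = linear_add[OF lin(1)] linear_add[OF lin(2)] linear_add[OF lin(3)]
    linear_diff[OF lin(1)] linear_diff[OF lin(2)] linear_diff[OF lin(3)]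
    linear_scale[OF lin(1)] linear_scale[OF lin(2)] linear_scale[OF lin(3)]
  have pH: "p1 H = 0" "p2 H = 0" "p3 H = Det"
    by (simp_all add: H_def pl pF Det_def M_def algebra_simps)
  have py: "p1 y = 0" "p2 y = M"
    by (simp_all add: y_def pl pF M_def algebra_simps)
  have G11: "G11 > 0"
    by (simp add: G11_def add_pos_nonneg)
  have "M = 1 + m1 * m1 + m2 * m2 + n1 * n1 + n2 * n2 + (m1 * n2 - m2 * n1)\<^sup>2"
    by (simp add: M_def G power2_eq_square algebra_simps)
  then have M: "M > 0"
    by (simp add: add_pos_nonneg)
  \<comment> \<open>The matrix \<open>G\<close> is the identity plus two rank-one matrices, built
    from the vectors \<open>m\<close> and \<open>n\<close>, so its determinant equals a 2 by 2 one.
    Lagrange's identity then writes it as 1 plus a sum of squares.\<close>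
  have Det_eq: "Det = (1 + m1 * m1 + m2 * m2 + m3 * m3) * (1 + n1 * n1 + n2 * n2 + n3 * n3)
      - (m1 * n1 + m2 * n2 + m3 * n3) * (m1 * n1 + m2 * n2 + m3 * n3)"
    by (simp add: Det_def M_def G algebra_simps)
  have "Det = 1 + m1 * m1 + m2 * m2 + m3 * m3 + n1 * n1 + n2 * n2 + n3 * n3
      + (m1 * n2 - m2 * n1)\<^sup>2 + (m2 * n3 - m3 * n2)\<^sup>2 + (m3 * n1 - m1 * n3)\<^sup>2"
    by (simp add: Det_eq power2_eq_square algebra_simps)
  then have Det: "Det > 0"
    by (simp add: add_pos_nonneg)
  define u where "u = e 4 - m1 *\<^sub>R e 1 - m2 *\<^sub>R e 2 - m3 *\<^sub>R e 3"
  define v where "v = e 5 - n1 *\<^sub>R e 1 - n2 *\<^sub>R e 2 - n3 *\<^sub>R e 3"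
  have puv: "p1 u = 0" "p2 u = 0" "p3 u = 0" "p1 v = 0" "p2 v = 0" "p3 v = 0"
    by (simp_all add: u_def v_def p_def co)
  let ?s = "span {F1, y, H, u, v}"
  note span_ops = span_add span_diff span_scale
  have s1: "F1 \<in> ?s" and y: "y \<in> ?s" and H: "H \<in> ?s" and u: "u \<in> ?s" and v: "v \<in> ?s"
    by (simp_all add: span_base)
  have "F2 = (1 / G11) *\<^sub>R (y + G12 *\<^sub>R F1)"
    using G11 by (simp add: y_def)
  then have s2: "F2 \<in> ?s"
    using s1 y by (metis span_ops)
  have "F3 = (1 / M) *\<^sub>R (H - (G12 * G23 - G13 * G22) *\<^sub>R F1 - (G13 * G12 - G11 * G23) *\<^sub>R F2)"
    using M by (simp add: H_def)
  then have s3: "F3 \<in> ?s"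
    using s1 s2 H by (metis span_ops)
  \<comment> \<open>Recovering \<open>e 4\<close> and \<open>e 5\<close> from the new vectors is a 2
    by 2 linear system whose determinant is again \<open>Det\<close>.\<close>
  define nm where "nm = 1 + m1 * m1 + m2 * m2 + m3 * m3"
  define nn where "nn = 1 + n1 * n1 + n2 * n2 + n3 * n3"
  define mn where "mn = m1 * n1 + m2 * n2 + m3 * n3"
  define p where "p = m1 *\<^sub>R F1 + m2 *\<^sub>R F2 + m3 *\<^sub>R F3 + u"
  define q where "q = n1 *\<^sub>R F1 + n2 *\<^sub>R F2 + n3 *\<^sub>R F3 + v"
  have pq: "p \<in> ?s" "q \<in> ?s"
    unfolding p_def q_def using s1 s2 s3 u v by (auto intro!: span_ops)
  have p_eq: "p = nm *\<^sub>R e 4 + mn *\<^sub>R e 5" and q_eq: "q = mn *\<^sub>R e 4 + nn *\<^sub>R e 5"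
    by (simp_all add: p_def q_def F u_def v_def nm_def nn_def mn_def algebra_simps)
  have d: "nm * nn - mn * mn = Det"
    by (simp add: Det_eq nm_def nn_def mn_def)
  have "Det *\<^sub>R e 4 = nn *\<^sub>R p - mn *\<^sub>R q" "Det *\<^sub>R e 5 = nm *\<^sub>R q - mn *\<^sub>R p"
    by (simp_all add: p_eq q_eq algebra_simps flip: d)
  then have "e 4 = (1 / Det) *\<^sub>R (nn *\<^sub>R p - mn *\<^sub>R q)" "e 5 = (1 / Det) *\<^sub>R (nm *\<^sub>R q - mn *\<^sub>R p)"
    using Det by (metis divide_self_if less_irrefl scaleR_one scaleR_scaleR times_divide_eq_left mult_1)+
  then have s45: "e 4 \<in> ?s" "e 5 \<in> ?s"
    using pq by (metis span_ops)+
  have "e 1 = F1 - m1 *\<^sub>R e 4 - n1 *\<^sub>R e 5" "e 2 = F2 - m2 *\<^sub>R e 4 - n2 *\<^sub>R e 5"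
    "e 3 = F3 - m3 *\<^sub>R e 4 - n3 *\<^sub>R e 5"
    by (simp_all add: F)
  then have s123: "e 1 \<in> ?s" "e 2 \<in> ?s" "e 3 \<in> ?s"
    using s1 s2 s3 s45 by (metis span_ops)+
  have span: "e i \<in> ?s" for i
    using exhaust_5[of i] s123 s45 by auto
  have b1: "br F1 y = (l * G11) *\<^sub>R H"
    by (simp add: br_eq b_def pF py H_def) (simp add: y_def pl pF M_def algebra_simps)
  have b2: "br y H = (l * (M * Det)) *\<^sub>R F1"
    by (simp add: br_eq b_def pH py)
  have b3: "br H F1 = (l * Det) *\<^sub>R y"
    by (simp add: br_eq b_def pH pF y_def algebra_simps)
  have pos: "0 < l * (M * Det) * (l * Det)" "0 < l * Det * (l * G11)"
  proof -
    have *: "l * (M * Det) * (l * Det) = l\<^sup>2 * (M * Det\<^sup>2)" "l * Det * (l * G11) = l\<^sup>2 * (Det * G11)"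
      by algebra+
    show "0 < l * (M * Det) * (l * Det)" "0 < l * Det * (l * G11)"
      unfolding * using \<open>l \<noteq> 0\<close> G11 M Det by simp_all
  qed
  have "lie_isomorphic br (so3 \<times> UNIV)
    (sum_bracket commutator (\<lambda>X Y. - vector [0, 0 * wedge 1 2 X Y]) :: (real^3^3) \<times> (real^2) \<Rightarrow> _)"
    by (rule lie_isomorphic_so3_plus[OF br e span pos b1 b2 b3]) (simp_all add: br_eq b_def puv)
  moreover have "(\<lambda>X Y :: real^2. - vector [0, 0 * wedge 1 2 X Y]) = (\<lambda>_ _. 0 :: real^2)"
    by (simp add: fun_eq_iff vec_eq_iff forall_2)
  ultimately show ?thesis
    unfolding iso_so3_plus_R2_def by simp
qed

text \<open>In dimension five the Jacobi identity for a totally skew structure tensor amounts to the Pluecker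
  relations, that is, to the decomposability of the three-form.\<close>

lemma iso_so3_plus_R2_skew_123:
  fixes e :: "5 \<Rightarrow> 'l::real_vector"
  assumes br: "lie_algebra br" and e: "is_frame e"
    and table: "\<And>i j. br (e i) (e j) = - (\<Sum>k\<in>UNIV. t i j k *\<^sub>R e k)"
    and skew: "\<And>i j k. t i j k = - t j i k" "\<And>i j k. t i j k = - t i k j"
    and nz: "t 1 2 3 \<noteq> 0"
  shows "iso_so3_plus_R2 br"
proof -
  have zero: "t i i k = 0" "t i k k = 0" "t i k i = 0" for i k
    using skew(1)[of i i k] skew(2)[of i k k] skew(1)[of i k i] skew(2)[of k i i] by simp_all
  have perm: "t 2 1 k = - t 1 2 k" "t 3 1 k = - t 1 3 k" "t 4 1 k = - t 1 4 k" "t 5 1 k = - t 1 5 k"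
    "t 3 2 k = - t 2 3 k" "t 4 2 k = - t 2 4 k" "t 5 2 k = - t 2 5 k" "t 4 3 k = - t 3 4 k"
    "t 5 3 k = - t 3 5 k" "t 5 4 k = - t 4 5 k" for k
    by (rule skew(1))+
  have perm': "t 1 3 2 = - t 1 2 3" "t 1 4 2 = - t 1 2 4" "t 1 5 2 = - t 1 2 5" "t 1 4 3 = - t 1 3 4"
    "t 1 5 3 = - t 1 3 5" "t 1 5 4 = - t 1 4 5" "t 2 4 3 = - t 2 3 4" "t 2 5 3 = - t 2 3 5"
    "t 2 5 4 = - t 2 4 5" "t 3 5 4 = - t 3 4 5"
    "t 2 3 1 = t 1 2 3" "t 2 4 1 = t 1 2 4" "t 2 5 1 = t 1 2 5" "t 3 4 1 = t 1 3 4" "t 3 5 1 = t 1 3 5"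
    "t 4 5 1 = t 1 4 5" "t 3 4 2 = t 2 3 4" "t 3 5 2 = t 2 3 5" "t 4 5 2 = t 2 4 5" "t 4 5 3 = t 3 4 5"
    using skew by metis+
  have jacobi: "coframe e l (br (e i) (br (e j) (e k))) + coframe e l (br (e j) (br (e k) (e i)))
    + coframe e l (br (e k) (br (e i) (e j))) = 0" for i j k l
  proof -
    have "br (e i) (br (e j) (e k)) + br (e j) (br (e k) (e i)) + br (e k) (br (e i) (e j)) = 0"
      using br by (simp add: lie_algebra_def)
    then show ?thesis
      by (metis coframe_add[OF e] coframe_zero[OF e])
  qed
  note js = table sum_5 zero perm perm' bilinear_simps[OF lie_algebra_bilinear[OF br]] coframe_simps[OF e]
    distinct_5 refl if_True if_False
  have pluecker: "t 1 2 3 * t 1 4 5 = t 1 2 4 * t 1 3 5 - t 1 2 5 * t 1 3 4"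
    "t 1 2 3 * t 2 4 5 = t 1 2 4 * t 2 3 5 - t 1 2 5 * t 2 3 4"
    "t 1 2 3 * t 3 4 5 = t 1 3 4 * t 2 3 5 - t 1 3 5 * t 2 3 4"
    using jacobi[of 4 2 3 5, simplified js] jacobi[of 4 1 3 5, simplified js] jacobi[of 4 1 2 5, simplified js]
    by algebra+
  \<comment> \<open>Contracting the three-form with two of \<open>e 1\<close>, \<open>e 2\<close>,
    \<open>e 3\<close> must give \<open>t 1 2 3\<close> times one of its factors, so the
    \<open>e 4\<close> and \<open>e 5\<close> components of the factors are these quotients. The
    Pluecker relations then supply the three components involving both 4 and 5.\<close>
  define m1 where "m1 = t 2 3 4 / t 1 2 3"
  define n1 where "n1 = t 2 3 5 / t 1 2 3"
  define m2 where "m2 = - t 1 3 4 / t 1 2 3"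
  define n2 where "n2 = - t 1 3 5 / t 1 2 3"
  define m3 where "m3 = t 1 2 4 / t 1 2 3"
  define n3 where "n3 = t 1 2 5 / t 1 2 3"
  have t: "t 2 3 4 = t 1 2 3 * m1" "t 2 3 5 = t 1 2 3 * n1" "t 1 3 4 = - (t 1 2 3 * m2)"
    "t 1 3 5 = - (t 1 2 3 * n2)" "t 1 2 4 = t 1 2 3 * m3" "t 1 2 5 = t 1 2 3 * n3"
    using nz by (simp_all add: m1_def n1_def m2_def n2_def m3_def n3_def)
  have t': "t 1 4 5 = t 1 2 3 * (m2 * n3 - m3 * n2)" "t 2 4 5 = t 1 2 3 * (m3 * n1 - m1 * n3)"
    "t 3 4 5 = t 1 2 3 * (m1 * n2 - m2 * n1)"
    using nz pluecker unfolding t by (simp_all add: field_simps) algebra+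
  show ?thesis
    by (rule iso_so3_plus_R2_decomposable[OF br e _ refl refl refl, where l = "- t 1 2 3"
          and ?m1.0 = m1 and ?m2.0 = m2 and ?m3.0 = m3 and ?n1.0 = n1 and ?n2.0 = n2 and ?n3.0 = n3])
      (use nz in \<open>simp_all add: table sum_5 zero perm perm' t t' algebra_simps\<close>)
qed

text \<open>A permutation of the frame preserves the form of the bracket table, so any nonzero
  component can be moved to position 1, 2, 3.\<close>

lemma iso_so3_plus_R2_skew:
  fixes e :: "5 \<Rightarrow> 'l::real_vector"
  assumes br: "lie_algebra br" and e: "is_frame e"
    and table: "\<And>i j. br (e i) (e j) = - (\<Sum>k\<in>UNIV. t i j k *\<^sub>R e k)"
    and skew: "\<And>i j k. t i j k = - t j i k" "\<And>i j k. t i j k = - t i k j"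
    and nz: "t i j k \<noteq> 0"
  shows "iso_so3_plus_R2 br"
proof -
  have "t i i k = 0" "t i k k = 0" "t i k i = 0" for i k
    using skew(1)[of i i k] skew(2)[of i k k] skew(1)[of i k i] skew(2)[of k i i] by simp_all
  then have ne: "i \<noteq> j" "j \<noteq> k" "i \<noteq> k"
    using nz by auto
  have "\<exists>p :: 5 \<Rightarrow> 5. bij p \<and> p 1 = i \<and> p 2 = j \<and> p 3 = k"
  proof -
    \<comment> \<open>Three transpositions put \<open>i\<close>, \<open>j\<close>, \<open>k\<close>
      in place one after the other. Distinctness of the indices and injectivity ensure that each
      leaves the earlier places alone.\<close>
    define p1 where "p1 = Transposition.transpose 1 i"
    define p2 where "p2 = Transposition.transpose (p1 2) j \<circ> p1"
    define p3 where "p3 = Transposition.transpose (p2 3) k \<circ> p2"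
    have bij1: "bij p1"
      by (simp add: p1_def)
    have bij2: "bij p2"
      unfolding p2_def by (intro bij_comp bij1) simp
    have bij3: "bij p3"
      unfolding p3_def by (intro bij_comp bij2) simp
    have "p1 1 = i"
      by (simp add: p1_def)
    moreover from this have "p2 1 = i" "p2 2 = j"
      using ne bij_is_inj[OF bij1] distinct_5(1)
      by (auto simp: p2_def Transposition.transpose_def inj_eq)
    moreover from this have "p3 1 = i" "p3 2 = j" "p3 3 = k"
      using ne bij_is_inj[OF bij2] distinct_5
      by (auto simp: p3_def Transposition.transpose_def inj_eq)
    ultimately show ?thesis
      using bij3 by blast
  qed
  then obtain p :: "5 \<Rightarrow> 5" where p: "bij p" "p 1 = i" "p 2 = j" "p 3 = k"
    by blast
  have "br ((e \<circ> p) x) ((e \<circ> p) y) = - (\<Sum>z\<in>UNIV. t (p x) (p y) (p z) *\<^sub>R (e \<circ> p) z)" for x y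
    using sum.reindex_bij_betw[OF p(1), of "\<lambda>k. t (p x) (p y) k *\<^sub>R e k"] by (simp add: table)
  moreover have "t (p x) (p y) (p z) = - t (p y) (p x) (p z)" "t (p x) (p y) (p z) = - t (p x) (p z) (p y)" for x y z
    using skew by blast+
  ultimately show ?thesis
    by (rule iso_so3_plus_R2_skew_123[OF br is_frame_permute[OF e p(1)], where t = "\<lambda>x y z. t (p x) (p y) (p z)"])
      (use nz p in simp)
qed

section \<open>The bracket in terms of connection and torsion\<close>

text \<open>
  Here \<open>f\<close> is the adapted frame with \<open>e\<^sub>1\<close> replaced by \<open>\<surd>3 e\<^sub>1\<close>, which makes all coefficients rational. Up to
  powers of \<open>\<surd>3\<close>, the parameters \<open>a, b, d\<close> are the coefficients of the connection along
  \<open>e\<^sub>1, e\<^sub>2, e\<^sub>4\<close> and \<open>P, Q, R, S\<close> those along \<open>e\<^sub>3, e\<^sub>5\<close>, where \<open>P, Q\<close> belong to the complex linear and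
  \<open>R, S\<close> to the antilinear part of the map from \<open>\<pp>\<close> to the plane of generators exchanging
  \<open>\<hh>\<close> and \<open>\<pp>\<close>. The torsion components are
  \<open>c = T\<^sub>1\<^sub>2\<^sub>4\<close>, \<open>t = T\<^sub>1\<^sub>3\<^sub>5\<close>, \<open>q = T\<^sub>2\<^sub>3\<^sub>5\<close>, \<open>r = T\<^sub>3\<^sub>4\<^sub>5\<close> and the obstructions to symmetry
  \<open>A = T\<^sub>1\<^sub>2\<^sub>3\<close>, \<open>B = T\<^sub>1\<^sub>2\<^sub>5\<close>, \<open>C = T\<^sub>1\<^sub>3\<^sub>4\<close>, \<open>E = T\<^sub>1\<^sub>4\<^sub>5\<close>, \<open>F = T\<^sub>2\<^sub>3\<^sub>4\<close>, \<open>G = T\<^sub>2\<^sub>4\<^sub>5\<close>.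
\<close>

locale so3_bracket =
  fixes br :: "'l::real_vector \<Rightarrow> 'l \<Rightarrow> 'l" and f :: "5 \<Rightarrow> 'l"
    and P Q R S a b d c t q r A B C E F G :: real
  assumes lie: "lie_algebra br" and frame: "is_frame f" and
    br12: "br (f 1) (f 2) = (- A) *\<^sub>R f 3 + (2 * a - c) *\<^sub>R f 4 + (- B) *\<^sub>R f 5" and
    br13: "br (f 1) (f 3) = A *\<^sub>R f 2 + (3/2 * P + 3/2 * R) *\<^sub>R f 3 + (- C) *\<^sub>R f 4
        + (3/2 * Q + 3/2 * S + a - t) *\<^sub>R f 5" and
    br14: "br (f 1) (f 4) = (- 2 * a + c) *\<^sub>R f 2 + C *\<^sub>R f 3 + (- E) *\<^sub>R f 5" and
    br15: "br (f 1) (f 5) = B *\<^sub>R f 2 + (- 3/2 * Q + 3/2 * S - a + t) *\<^sub>R f 3 + E *\<^sub>R f 4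
        + (3/2 * P - 3/2 * R) *\<^sub>R f 5" and
    br23: "br (f 2) (f 3) = (- 1/3 * A) *\<^sub>R f 1 + (1/2 * Q + 1/2 * S) *\<^sub>R f 3 + (- F) *\<^sub>R f 4
        + (1/2 * P + 1/2 * R + b - q) *\<^sub>R f 5" and
    br24: "br (f 2) (f 4) = (- 1/3 * c) *\<^sub>R f 1 + (- 2 * b) *\<^sub>R f 2 + F *\<^sub>R f 3
        + (- 2 * d) *\<^sub>R f 4 + (- G) *\<^sub>R f 5" and
    br25: "br (f 2) (f 5) = (- 1/3 * B) *\<^sub>R f 1 + (1/2 * P - 1/2 * R - b + q) *\<^sub>R f 3
        + G *\<^sub>R f 4 + (- 1/2 * Q + 1/2 * S) *\<^sub>R f 5" and
    br34: "br (f 3) (f 4) = (- 1/3 * C) *\<^sub>R f 1 + (- F) *\<^sub>R f 2 + (1/2 * P + 1/2 * R) *\<^sub>R f 3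
        + (- 1/2 * Q - 1/2 * S - d - r) *\<^sub>R f 5" and
    br35: "br (f 3) (f 5) = (Q - 1/3 * t) *\<^sub>R f 1 + (R - q) *\<^sub>R f 2 + (S + r) *\<^sub>R f 4" and
    br45: "br (f 4) (f 5) = (- 1/3 * E) *\<^sub>R f 1 + (- G) *\<^sub>R f 2
        + (1/2 * Q - 1/2 * S - d - r) *\<^sub>R f 3 + (1/2 * P - 1/2 * R) *\<^sub>R f 5"
begin

lemmas bracket_linear = bilinear_simps[OF lie_algebra_bilinear[OF lie]]

lemma bracket_swap:
  "br (f 2) (f 1) = - br (f 1) (f 2)" "br (f 3) (f 1) = - br (f 1) (f 3)"
  "br (f 4) (f 1) = - br (f 1) (f 4)" "br (f 5) (f 1) = - br (f 1) (f 5)"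
  "br (f 3) (f 2) = - br (f 2) (f 3)" "br (f 4) (f 2) = - br (f 2) (f 4)"
  "br (f 5) (f 2) = - br (f 2) (f 5)" "br (f 4) (f 3) = - br (f 3) (f 4)"
  "br (f 5) (f 3) = - br (f 3) (f 5)" "br (f 5) (f 4) = - br (f 4) (f 5)"
  by (rule lie_algebra_skew[OF lie])+

lemmas bracket_simps = bracket_linear bracket_swap lie_algebra_self[OF lie]
  br12 br13 br14 br15 br23 br24 br25 br34 br35 br45

lemma jacobi_coframe:
  "coframe f l (br (f i) (br (f j) (f k))) + coframe f l (br (f j) (br (f k) (f i)))
    + coframe f l (br (f k) (br (f i) (f j))) = 0"
proof -
  have "br (f i) (br (f j) (f k)) + br (f j) (br (f k) (f i)) + br (f k) (br (f i) (f j)) = 0"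
    using lie by (simp add: lie_algebra_def)
  then show ?thesis
    by (metis coframe_add[OF frame] coframe_zero[OF frame])
qed

lemmas jacobi_simps =
  bracket_simps coframe_simps[OF frame] distinct_5 refl if_True if_False

text \<open>In this family \<open>jacobi_ijk_l\<close> is the \<open>f l\<close> component of the
  Jacobi identity for \<open>f i\<close>, \<open>f j\<close>, \<open>f k\<close>, with denominators
  cleared. It is odd in the obstructions when an odd number of the four indices lies in {3, 5}, and
  even otherwise.\<close>

lemma jacobi_123_1: "3 * A * P + 3 * A * R - 3 * B * Q + 3 * B * S + 2 * B * a - 4 * C * a = 0"
  using jacobi_coframe[of 1 1 2 3]
  by (simp only: jacobi_simps) algebra

lemma jacobi_123_2: "A * Q + A * S + B * P - B * R + 2 * B * b - 4 * C * b = 0"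
  using jacobi_coframe[of 2 1 2 3]
  by (simp only: jacobi_simps) algebra

lemma jacobi_123_3: "- 3 * P * Q - P * c + 2 * P * t + 3 * R * S + 2 * R * a - R * c + 6 * S * b - 6 * S * q = 0"
  using jacobi_coframe[of 3 1 2 3]
  by (simp only: jacobi_simps) algebra

lemma jacobi_123_4: "- 2 * B * S - 2 * B * r - C * Q - C * S - 4 * C * d + E * P + E * R + 2 * E * b - 2 * E * q
  + 3 * F * P + 3 * F * R - 3 * G * Q - 3 * G * S - 2 * G * a + 2 * G * t = 0"
  using jacobi_coframe[of 4 1 2 3]
  by (simp only: jacobi_simps) algebra

lemma jacobi_123_5: "- 2 * C * G + 2 * E * F - 3 * P * R + 3 * Q * S + Q * c - 2 * Q * t + 3 * Q\<^sup>2 - 6 * R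
  * b + 6 * R * q - 3 * R\<^sup>2 - 2 * S * a + S * c - 4 * a * d - 4 * a * r + 2 * c * d + 2
  * c * r = 0"
  using jacobi_coframe[of 5 1 2 3]
  by (simp only: jacobi_simps) algebra

lemma jacobi_124_2: "4 * a * d - 2 * c * d = 0"
  using jacobi_coframe[of 2 1 2 4]
  by (simp only: jacobi_simps) algebra

lemma jacobi_124_3: "A * P + A * R + 4 * A * b - B * Q + B * S + 2 * B * d + 2 * B * r - C * Q - C * S - 4 * C *
  d + E * P - E * R - 2 * E * b + 2 * E * q + 3 * F * P + 3 * F * R + 3 * G * Q - 3 * G * S +
  2 * G * a - 2 * G * t = 0"
  using jacobi_coframe[of 3 1 2 4]
  by (simp only: jacobi_simps) algebra

lemma jacobi_124_4: "- 4 * a * b + 2 * b * c = 0"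
  using jacobi_coframe[of 4 1 2 4]
  by (simp only: jacobi_simps) algebra

lemma jacobi_124_5: "- A * Q - A * S - 2 * A * d - 2 * A * r - B * P + B * R + 4 * B * b - C * P - C * R - 2 * C
  * b + 2 * C * q - E * Q + E * S + 4 * E * d + 3 * F * Q + 3 * F * S + 2 * F * a - 2 * F * t
  - 3 * G * P + 3 * G * R = 0"
  using jacobi_coframe[of 5 1 2 4]
  by (simp only: jacobi_simps) algebra

lemma jacobi_125_1: "3 * A * Q + 3 * A * S - 2 * A * a + 3 * B * P - 3 * B * R + 4 * E * a = 0"
  using jacobi_coframe[of 1 1 2 5]
  by (simp only: jacobi_simps) algebra

lemma jacobi_125_2: "A * P + A * R - 2 * A * b - B * Q + B * S + 4 * E * b = 0"
  using jacobi_coframe[of 2 1 2 5]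
  by (simp only: jacobi_simps) algebra

lemma jacobi_125_3: "2 * C * G - 2 * E * F + 3 * P * R - 3 * Q * S + Q * c - 2 * Q * t + 3 * Q\<^sup>2 - 6 * R *
  b + 6 * R * q - 3 * R\<^sup>2 + 2 * S * a - S * c + 4 * a * d + 4 * a * r - 2 * c * d - 2 *
  c * r = 0"
  using jacobi_coframe[of 3 1 2 5]
  by (simp only: jacobi_simps) algebra

lemma jacobi_125_4: "2 * A * S + 2 * A * r - C * P + C * R + 2 * C * b - 2 * C * q - E * Q + E * S + 4 * E * d -
  3 * F * Q + 3 * F * S - 2 * F * a + 2 * F * t - 3 * G * P + 3 * G * R = 0"
  using jacobi_coframe[of 4 1 2 5]
  by (simp only: jacobi_simps) algebra

lemma jacobi_125_5: "3 * P * Q + P * c - 2 * P * t - 3 * R * S + 2 * R * a - R * c - 6 * S * b + 6 * S * q = 0"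
  using jacobi_coframe[of 5 1 2 5]
  by (simp only: jacobi_simps) algebra

lemma jacobi_134_1: "4 * A * a + 3 * C * P + 3 * C * R + 3 * E * Q - 3 * E * S - 2 * E * a = 0"
  using jacobi_coframe[of 1 1 3 4]
  by (simp only: jacobi_simps) algebra

lemma jacobi_134_2: "A * P + A * R + 4 * A * b - B * Q - B * S - 2 * B * d - 2 * B * r + 2 * E * R - 2 * E * q +
  3 * F * P + 3 * F * R - 3 * G * Q - 3 * G * S - 2 * G * a + 2 * G * t = 0"
  using jacobi_coframe[of 2 1 3 4]
  by (simp only: jacobi_simps) algebra

lemma jacobi_134_3: "Q * c - 2 * Q * t + 3 * Q\<^sup>2 - 2 * S * a + S * c - 6 * S * d - 6 * S * r - 3 *
  S\<^sup>2 = 0"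
  using jacobi_coframe[of 3 1 3 4]
  by (simp only: jacobi_simps) algebra

lemma jacobi_134_4: "4 * A * d - C * P - C * R - E * Q + E * S - 2 * E * d = 0"
  using jacobi_coframe[of 4 1 3 4]
  by (simp only: jacobi_simps) algebra

lemma jacobi_134_5: "2 * A * G + 2 * B * F + 3 * P * Q + 3 * P * S + P * c - 2 * P * t + 3 * Q * R + 3 * R * S -
  2 * R * a + R * c + 6 * R * d + 6 * R * r - 4 * a * b + 4 * a * q + 2 * b * c - 2 * c * q = 0"
  using jacobi_coframe[of 5 1 3 4]
  by (simp only: jacobi_simps) algebra

lemma jacobi_135_1: "- 3 * P * Q + P * t = 0"
  using jacobi_coframe[of 1 1 3 5]
  by (simp only: jacobi_simps) algebra

lemma jacobi_135_2: "- C * G + E * F - 3 * P * R + 3 * P * q - 2 * S * a + S * c - 2 * a * r + c * r = 0"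
  using jacobi_coframe[of 2 1 3 5]
  by (simp only: jacobi_simps) algebra

lemma jacobi_135_4: "- A * G - B * F - 3 * P * S - 3 * P * r + 2 * R * a - R * c - 2 * a * q + c * q = 0"
  using jacobi_coframe[of 4 1 3 5]
  by (simp only: jacobi_simps) algebra

lemma jacobi_145_1: "- 4 * B * a - 3 * C * Q - 3 * C * S + 2 * C * a + 3 * E * P - 3 * E * R = 0"
  using jacobi_coframe[of 1 1 4 5]
  by (simp only: jacobi_simps) algebra

lemma jacobi_145_2: "A * Q - A * S - 2 * A * d - 2 * A * r + B * P - B * R - 4 * B * b - 2 * C * R + 2 * C * q +
  3 * F * Q - 3 * F * S + 2 * F * a - 2 * F * t + 3 * G * P - 3 * G * R = 0"
  using jacobi_coframe[of 2 1 4 5]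
  by (simp only: jacobi_simps) algebra

lemma jacobi_145_3: "2 * A * G + 2 * B * F - 3 * P * Q + 3 * P * S - P * c + 2 * P * t + 3 * Q * R - 3 * R * S -
  2 * R * a + R * c - 6 * R * d - 6 * R * r - 4 * a * b + 4 * a * q + 2 * b * c - 2 * c * q = 0"
  using jacobi_coframe[of 3 1 4 5]
  by (simp only: jacobi_simps) algebra

lemma jacobi_145_4: "- 4 * B * d - C * Q - C * S + 2 * C * d + E * P - E * R = 0"
  using jacobi_coframe[of 4 1 4 5]
  by (simp only: jacobi_simps) algebra

lemma jacobi_145_5: "Q * c - 2 * Q * t + 3 * Q\<^sup>2 + 2 * S * a - S * c - 6 * S * d - 6 * S * r - 3 *
  S\<^sup>2 = 0"
  using jacobi_coframe[of 5 1 4 5]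
  by (simp only: jacobi_simps) algebra

lemma jacobi_234_1: "- A * P - A * R + 4 * A * b + B * Q + B * S + 2 * B * d + 2 * B * r + C * Q + C * S - 4 * C
  * d - E * P - E * R - 2 * E * b + 2 * E * q + 6 * G * Q - 2 * G * t = 0"
  using jacobi_coframe[of 1 2 3 4]
  by (simp only: jacobi_simps) algebra

lemma jacobi_234_2: "- 4 * A * a + 3 * F * Q + 3 * F * S - 12 * F * d - 3 * G * P + 3 * G * R - 6 * G * b = 0"
  using jacobi_coframe[of 2 2 3 4]
  by (simp only: jacobi_simps) algebra

lemma jacobi_234_3: "- P * S - P * c - 2 * P * r + Q * R - 2 * Q * q - R * c + 2 * R * d - 2 * S * b = 0"
  using jacobi_coframe[of 3 2 3 4]
  by (simp only: jacobi_simps) algebra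

lemma jacobi_234_4: "4 * C * a - 3 * F * P - 3 * F * R + 12 * F * b - 3 * G * Q + 3 * G * S - 6 * G * d = 0"
  using jacobi_coframe[of 4 2 3 4]
  by (simp only: jacobi_simps) algebra

lemma jacobi_234_5: "- 2 * A * E - 2 * B * C + 3 * P * R - 6 * P * q + 3 * P\<^sup>2 + 3 * Q * S - 3 * Q * c + 6
  * Q * r + 3 * Q\<^sup>2 - 6 * R * b - 3 * S * c - 6 * S * d - 2 * a * c + 12 * b * q - 12 *
  b\<^sup>2 + 2 * c * t - 12 * d * r - 12 * d\<^sup>2 = 0"
  using jacobi_coframe[of 5 2 3 4]
  by (simp only: jacobi_simps) algebra

lemma jacobi_235_1: "C * G - E * F - 3 * Q * S - S * c + S * t - c * r = 0"
  using jacobi_coframe[of 1 2 3 5]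
  by (simp only: jacobi_simps) algebra

lemma jacobi_235_2: "- R * S - 2 * S * b + S * q - 2 * b * r = 0"
  using jacobi_coframe[of 2 2 3 5]
  by (simp only: jacobi_simps) algebra

lemma jacobi_235_3: "3 * A * Q + 3 * A * S - 2 * A * a - 3 * B * P - 3 * B * R + 3 * F * Q + 3 * F * S - 6 * F *
  d - 3 * G * P - 3 * G * R = 0"
  using jacobi_coframe[of 3 2 3 5]
  by (simp only: jacobi_simps) algebra

lemma jacobi_235_4: "A * E + B * C - 6 * Q * a + 3 * Q * c - 6 * S * d - 3 * S * r - 3 * S\<^sup>2 + 2 * a * t -
  c * t - 6 * d * r = 0"
  using jacobi_coframe[of 4 2 3 5]
  by (simp only: jacobi_simps) algebra

lemma jacobi_235_5: "3 * A * P - 3 * A * R + 3 * B * Q - 3 * B * S - 2 * B * a + 3 * F * P - 3 * F * R + 3 * G *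
  Q - 3 * G * S + 6 * G * d = 0"
  using jacobi_coframe[of 5 2 3 5]
  by (simp only: jacobi_simps) algebra

lemma jacobi_245_1: "- A * Q + A * S + 2 * A * d + 2 * A * r - B * P + B * R - 4 * B * b - C * P + C * R + 2 * C
  * b - 2 * C * q - E * Q + E * S - 4 * E * d - 6 * F * Q + 2 * F * t = 0"
  using jacobi_coframe[of 1 2 4 5]
  by (simp only: jacobi_simps) algebra

lemma jacobi_245_2: "4 * B * a - 3 * F * P - 3 * F * R + 6 * F * b - 3 * G * Q + 3 * G * S - 12 * G * d = 0"
  using jacobi_coframe[of 2 2 4 5]
  by (simp only: jacobi_simps) algebra

lemma jacobi_245_3: "- 2 * A * E - 2 * B * C - 3 * P * R + 6 * P * q + 3 * P\<^sup>2 - 3 * Q * S - 3 * Q * c - 6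
  * Q * r + 3 * Q\<^sup>2 - 6 * R * b + 3 * S * c - 6 * S * d - 2 * a * c + 12 * b * q - 12 *
  b\<^sup>2 + 2 * c * t - 12 * d * r - 12 * d\<^sup>2 = 0"
  using jacobi_coframe[of 3 2 4 5]
  by (simp only: jacobi_simps) algebra

lemma jacobi_245_4: "4 * E * a - 3 * F * Q - 3 * F * S + 6 * F * d + 3 * G * P - 3 * G * R + 12 * G * b = 0"
  using jacobi_coframe[of 4 2 4 5]
  by (simp only: jacobi_simps) algebra

lemma jacobi_245_5: "- P * S + P * c - 2 * P * r + Q * R - 2 * Q * q - R * c - 2 * R * d + 2 * S * b = 0"
  using jacobi_coframe[of 5 2 4 5]
  by (simp only: jacobi_simps) algebra

lemma jacobi_345_1: "- A * G - B * F - 3 * Q * R - R * c + R * t + c * q = 0"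
  using jacobi_coframe[of 1 3 4 5]
  by (simp only: jacobi_simps) algebra

lemma jacobi_345_2: "A * E + B * C - 6 * Q * a + 3 * Q * c - 6 * R * b + 3 * R * q - 3 * R\<^sup>2 + 2 * a * t +
  6 * b * q - c * t = 0"
  using jacobi_coframe[of 2 3 4 5]
  by (simp only: jacobi_simps) algebra

lemma jacobi_345_3: "3 * C * Q + 3 * C * S - 2 * C * a + 3 * E * P + 3 * E * R + 3 * F * P + 3 * F * R - 6 * F *
  b + 3 * G * Q + 3 * G * S = 0"
  using jacobi_coframe[of 3 3 4 5]
  by (simp only: jacobi_simps) algebra

lemma jacobi_345_4: "- R * S - 2 * R * d - R * r + 2 * d * q = 0"
  using jacobi_coframe[of 4 3 4 5]
  by (simp only: jacobi_simps) algebra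

lemma jacobi_345_5: "3 * C * P - 3 * C * R - 3 * E * Q + 3 * E * S + 2 * E * a - 3 * F * Q + 3 * F * S + 3 * G *
  P - 3 * G * R + 6 * G * b = 0"
  using jacobi_coframe[of 5 3 4 5]
  by (simp only: jacobi_simps) algebra

section \<open>Solving the Jacobi equations\<close>

text \<open>Linear combinations of the Jacobi equations, found by Gaussian elimination so that each has few terms.\<close>

lemma relation_1: "3 * P * Q - 4 * P * c + 3 * R * S + 6 * R * d - 6 * S * q = 0"
  using jacobi_123_3 jacobi_125_5 jacobi_135_1 jacobi_234_3 jacobi_245_5
  by linarith

lemma relation_2: "- 2 * a * d + c * d = 0"
  using jacobi_124_2
  by linarith

lemma relation_3: "- 2 * a * b + b * c = 0"
  using jacobi_124_4
  by linarith

lemma relation_4: "- Q * c + 2 * Q * t - 3 * Q\<^sup>2 + 6 * R * b - 6 * R * q + 3 * R\<^sup>2 = 0"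
  using jacobi_123_5 jacobi_125_3
  by linarith

lemma relation_5: "2 * Q * q + R * c = 0"
  using jacobi_123_3 jacobi_124_4 jacobi_125_5 jacobi_134_5 jacobi_135_4 jacobi_145_3 jacobi_234_3
    jacobi_245_5
  by linarith

lemma relation_6: "2 * Q * r - S * c = 0"
  using jacobi_123_5 jacobi_124_2 jacobi_125_3 jacobi_134_3 jacobi_135_2 jacobi_145_5 jacobi_234_5
    jacobi_245_3
  by linarith

lemma relation_7: "Q * r - S * a = 0"
  using jacobi_123_5 jacobi_124_2 jacobi_125_3 jacobi_134_3 jacobi_135_2 jacobi_145_5 jacobi_234_5
    jacobi_245_3
  by linarith

lemma relation_8: "Q * q + R * a = 0"
  using jacobi_123_3 jacobi_124_4 jacobi_125_5 jacobi_134_5 jacobi_135_4 jacobi_145_3 jacobi_234_3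
    jacobi_245_5
  by linarith

lemma relation_9: "- Q * c + 2 * Q * t - 3 * Q\<^sup>2 + 6 * S * d + 6 * S * r + 3 * S\<^sup>2 = 0"
  using jacobi_134_3 jacobi_145_5
  by linarith

lemma relation_10: "- 3 * P * Q + P * t = 0"
  using jacobi_135_1
  by linarith

lemma relation_11: "- 3 * P * Q + P * c + 3 * R * S + 6 * R * d + 6 * R * r = 0"
  using jacobi_134_5 jacobi_135_1 jacobi_145_3
  by linarith

lemma relation_12: "P * S + 2 * P * r - Q * R = 0"
  using jacobi_123_3 jacobi_124_4 jacobi_125_5 jacobi_134_5 jacobi_135_4 jacobi_145_3
  by linarith

lemma relation_13: "P * R - 2 * P * q + Q * S = 0"
  using jacobi_123_5 jacobi_124_2 jacobi_125_3 jacobi_134_3 jacobi_135_2 jacobi_145_5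
  by linarith

lemma relation_14: "P * c - 2 * R * d + 2 * S * b = 0"
  using jacobi_234_3 jacobi_245_5
  by linarith

lemma relation_15: "- 3 * P\<^sup>2 + 12 * Q * a - Q * c - 4 * Q * t + 3 * Q\<^sup>2 + 6 * R * b + 12 * R * q +
  6 * S * d + 6 * S * r + 2 * a * c - 4 * a * t - 36 * b * q + 12 * b\<^sup>2 + 12 * d\<^sup>2 = 0"
  using jacobi_123_5 jacobi_125_3 jacobi_134_3 jacobi_145_5 jacobi_234_5 jacobi_235_4 jacobi_245_3
    jacobi_345_2
  by linarith

lemma relation_16: "3 * P * q + 2 * Q * r - S * t + 2 * a * r = 0"
  using jacobi_123_5 jacobi_124_2 jacobi_125_3 jacobi_134_3 jacobi_135_2 jacobi_145_5 jacobi_234_5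
    jacobi_235_1 jacobi_245_3
  by linarith

lemma relation_17: "3 * P * r - 2 * Q * q - R * t - 2 * a * q = 0"
  using jacobi_123_3 jacobi_124_4 jacobi_125_5 jacobi_134_5 jacobi_135_4 jacobi_145_3 jacobi_234_3
    jacobi_245_5 jacobi_345_1
  by linarith

lemma relation_18: "- 3 * P * Q - 2 * P * c + 3 * R * S + 6 * R * d + 12 * b * r = 0"
  using jacobi_123_3 jacobi_125_5 jacobi_135_1 jacobi_234_3 jacobi_235_2 jacobi_245_5
  by linarith

lemma relation_19: "3 * P * Q - P * c + 3 * R * S + 6 * R * d - 12 * d * q = 0"
  using jacobi_134_5 jacobi_135_1 jacobi_145_3 jacobi_345_4
  by linarith

lemma relation_20: "- R * q - S * r + 2 * b * q + 2 * d * r = 0"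
  using jacobi_123_5 jacobi_125_3 jacobi_134_3 jacobi_145_5 jacobi_235_4 jacobi_345_2
  by linarith

lemma relation_21: "- C * G + E * F - 3 * P * R + 6 * P * q + 2 * Q * r - S * t + c * r = 0"
  using jacobi_123_5 jacobi_124_2 jacobi_125_3 jacobi_134_3 jacobi_135_2 jacobi_145_5 jacobi_234_5
    jacobi_235_1 jacobi_245_3
  by linarith

lemma relation_22: "A * G + B * F + 3 * P * S + 6 * P * r - 2 * Q * q - R * t - c * q = 0"
  using jacobi_123_3 jacobi_124_4 jacobi_125_5 jacobi_134_5 jacobi_135_4 jacobi_145_3 jacobi_234_3
    jacobi_245_5 jacobi_345_1
  by linarith

lemma relation_23: "A * E + B * C - 6 * Q * a + 2 * Q * c + 2 * Q * t - 3 * Q\<^sup>2 - 3 * R * q + 2 * a * t +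
  6 * b * q - c * t = 0"
  using jacobi_123_5 jacobi_125_3 jacobi_345_2
  by linarith

lemma relation_24: "3 * A * b - 5 * B * a + 6 * B * d + 4 * C * a = 0"
  using jacobi_123_1 jacobi_123_4 jacobi_125_2 jacobi_134_2 jacobi_145_1 jacobi_145_4
  by linarith

lemma relation_25: "- 5 * A * a - 6 * A * d + 3 * B * b + 4 * E * a = 0"
  using jacobi_123_2 jacobi_125_1 jacobi_125_4 jacobi_134_1 jacobi_134_4 jacobi_145_2
  by linarith

lemma relation_26: "A * a + 2 * A * d - 3 * B * b + 4 * C * b = 0"
  using jacobi_123_2 jacobi_125_1 jacobi_125_4 jacobi_134_1 jacobi_134_4 jacobi_145_2
  by linarith

lemma relation_27: "- 3 * A * b + B * a - 2 * B * d + 4 * E * b = 0"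
  using jacobi_123_1 jacobi_123_4 jacobi_125_2 jacobi_134_2 jacobi_145_1 jacobi_145_4
  by linarith

lemma relation_28: "A * b + B * a - 6 * B * d + 4 * C * d = 0"
  using jacobi_123_1 jacobi_123_4 jacobi_125_2 jacobi_134_2 jacobi_145_1 jacobi_145_4
  by linarith

lemma relation_29: "- A * a - 6 * A * d - B * b + 4 * E * d = 0"
  using jacobi_123_2 jacobi_125_1 jacobi_125_4 jacobi_134_1 jacobi_134_4 jacobi_145_2
  by linarith

end

text \<open>The hypotheses come from \<open>(a C) d = (d C) a\<close> and its analogues, where the products of \<open>a, b, d\<close> with \<open>C\<close>
  and \<open>E\<close> have been eliminated by linear relations.\<close>

lemma rank_one_relations:
  fixes A B a b d :: real
  assumes "B * (a - 3 * d) * (a + 2 * d) = - A * b * (a - 3 * d)"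
    and "2 * b * (a - 3 * d) * B = A * (3 * b\<^sup>2 - a\<^sup>2 - 2 * a * d)"
    and "A * (b\<^sup>2 - a * d - 2 * d\<^sup>2) = - b * (a - 3 * d) * B"
    and "2 * b * (a + 3 * d) * A = B * (3 * b\<^sup>2 - a\<^sup>2 + 2 * a * d)"
    and "A * (a + 3 * d) * (a - 2 * d) = - B * b * (a + 3 * d)"
    and "B * (b\<^sup>2 + a * d - 2 * d\<^sup>2) = - b * (a + 3 * d) * A"
    and "A \<noteq> 0"
  shows "a = 0 \<and> b = 0 \<and> d = 0"
proof -
  have "A * (5 * b\<^sup>2 - (a + 2 * d)\<^sup>2) = 0" "B * (5 * b\<^sup>2 - (a - 2 * d)\<^sup>2) = 0"
    using assms(2,3,4,6) by (simp_all add: power2_eq_square algebra_simps)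
  then have b: "5 * b\<^sup>2 = (a + 2 * d)\<^sup>2" and b': "B = 0 \<or> 5 * b\<^sup>2 = (a - 2 * d)\<^sup>2"
    using \<open>A \<noteq> 0\<close> by auto
  consider "a = 3 * d" | "a = - 3 * d" | "a - 3 * d \<noteq> 0" "a + 3 * d \<noteq> 0"
    by linarith
  then show ?thesis
  proof cases
    case 1
    have "d = 0"
    proof (rule ccontr)
      assume "d \<noteq> 0"
      have b2: "b\<^sup>2 = 5 * d\<^sup>2"
        using b 1 by (simp add: power2_eq_square)
      have "d * (B * d - b * A) = 0"
        using assms(4) b2 unfolding 1 by algebra
      moreover have "d * (A * d + b * B) = 0"
        using assms(5) 1 by (simp add: algebra_simps)
      ultimately have "B * d = b * A" "A * d = - (b * B)"
        using \<open>d \<noteq> 0\<close> by auto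
      then have "A * (b\<^sup>2 + d\<^sup>2) = 0"
        by algebra
      then show False
        using \<open>A \<noteq> 0\<close> \<open>d \<noteq> 0\<close> by (simp add: sum_power2_eq_zero_iff)
    qed
    then show ?thesis
      using 1 b by simp
  next
    case 2
    have d2: "d\<^sup>2 = 5 * b\<^sup>2"
      using b 2 by (simp add: power2_eq_square)
    have "B * b\<^sup>2 = 0"
      using assms(6) d2 unfolding 2 by algebra
    then have "B * b = 0"
      by simp
    moreover have "A * (b\<^sup>2 + d\<^sup>2) = 6 * d * (B * b)"
      using assms(3) 2 by (simp add: power2_eq_square algebra_simps)
    ultimately have "A * (b\<^sup>2 + d\<^sup>2) = 0"
      by (simp only: mult_zero_right)
    then have "b\<^sup>2 + d\<^sup>2 = 0"
      using \<open>A \<noteq> 0\<close> by (simp only: mult_eq_0_iff simp_thms)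
    then show ?thesis
      using 2 by (simp add: sum_power2_eq_zero_iff)
  next
    case 3
    have 31: "B * (a + 2 * d) = - A * b"
      using assms(1) 3(1) by algebra
    have 32: "A * (a - 2 * d) = - B * b"
      using assms(5) 3(2) by algebra
    have "b = 0 \<and> a = 2 * d"
    proof (cases "B = 0")
      case True
      then show ?thesis
        using 31 32 \<open>A \<noteq> 0\<close> by simp
    next
      case False
      then have "5 * b\<^sup>2 = (a - 2 * d)\<^sup>2"
        using b' by simp
      then have "A\<^sup>2 * (5 * b\<^sup>2) = B\<^sup>2 * b\<^sup>2" "B\<^sup>2 * (5 * b\<^sup>2) = A\<^sup>2 * b\<^sup>2"
        using 31 32 b by algebra+
      then have "(A * b)\<^sup>2 = 0"
        by algebra
      then have "b = 0"
        using \<open>A \<noteq> 0\<close> by simp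
      then show ?thesis
        using 32 \<open>A \<noteq> 0\<close> by simp
    qed
    then show ?thesis
      using b by simp
  qed
qed

context so3_bracket
begin

text \<open>The odd equations first annihilate \<open>a\<close>, \<open>b\<close>, \<open>d\<close>:
  through \<open>C\<close> and \<open>E\<close>, or through \<open>A\<close> and \<open>B\<close>
  after \<open>C\<close> and \<open>E\<close> have been eliminated. The even relations then dispose
  of \<open>P\<close>, \<open>Q\<close>, \<open>R\<close>, \<open>S\<close>. When only
  \<open>F\<close> or \<open>G\<close> survives, the odd equations alone suffice.\<close>

lemma flat_if_not_symmetric:
  assumes "\<not> (A = 0 \<and> B = 0 \<and> C = 0 \<and> E = 0 \<and> F = 0 \<and> G = 0)"
  shows "a = 0 \<and> b = 0 \<and> d = 0 \<and> P = 0 \<and> Q = 0 \<and> R = 0 \<and> S = 0"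
proof (cases "A = 0 \<and> B = 0 \<and> C = 0 \<and> E = 0")
  case True
  then have FG: "F \<noteq> 0 \<or> G \<noteq> 0"
    using assms by simp
  have zero: "A = 0" "B = 0" "C = 0" "E = 0"
    using True by simp_all
  note jacobi = jacobi_123_4 jacobi_124_3 jacobi_124_5 jacobi_125_4 jacobi_234_1 jacobi_234_2
    jacobi_234_4 jacobi_235_3 jacobi_235_5 jacobi_245_1 jacobi_245_2 jacobi_245_4 jacobi_345_3 jacobi_345_5
  have FG0: "X = 0" if "F * X = 0" "G * X = 0" for X
    using FG that by auto
  \<comment> \<open>A linear system in \<open>Q\<close> and \<open>P\<close> with determinant 6
    times the sum of the squares of \<open>F\<close> and \<open>G\<close>.\<close>
  have PQ: "2 * (F * Q) = 3 * (G * P)" "2 * (G * Q) = - 3 * (F * P)"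
    using jacobi unfolding zero by algebra+
  have "Q = 0 \<and> P = 0"
  proof -
    have "(F\<^sup>2 + G\<^sup>2) * Q = 0" "(F\<^sup>2 + G\<^sup>2) * P = 0"
      using PQ by algebra+
    moreover have "F\<^sup>2 + G\<^sup>2 \<noteq> 0"
      using FG by (simp add: sum_power2_eq_zero_iff)
    ultimately show ?thesis
      by auto
  qed
  then have PQ0: "P = 0" "Q = 0"
    by simp_all
  note jacobi' = jacobi[unfolded zero PQ0]
  have "a = 0" "b = 0" "d = 0" "R = 0" "S = 0"
    by (rule FG0; use jacobi' in algebra)+
  then show ?thesis
    using PQ0 by simp
next
  case False
  have abd: "a = 0 \<and> b = 0 \<and> d = 0"
  proof (cases "A = 0 \<and> B = 0")
    case True
    then have "C \<noteq> 0 \<or> E \<noteq> 0"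
      using False by simp
    then show ?thesis
      using True relation_24 relation_25 relation_26 relation_27 relation_28 relation_29 by auto
  next
    case AB: False
    have *: "B * (a - 3 * d) * (a + 2 * d) = - A * b * (a - 3 * d)"
      "2 * b * (a - 3 * d) * B = A * (3 * b\<^sup>2 - a\<^sup>2 - 2 * a * d)"
      "A * (b\<^sup>2 - a * d - 2 * d\<^sup>2) = - b * (a - 3 * d) * B"
      "2 * b * (a + 3 * d) * A = B * (3 * b\<^sup>2 - a\<^sup>2 + 2 * a * d)"
      "A * (a + 3 * d) * (a - 2 * d) = - B * b * (a + 3 * d)"
      "B * (b\<^sup>2 + a * d - 2 * d\<^sup>2) = - b * (a + 3 * d) * A"
      using relation_24 relation_25 relation_26 relation_27 relation_28 relation_29 by algebra+
    show ?thesis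
    proof (cases "A = 0")
      case False
      then show ?thesis
        by (rule rank_one_relations[OF *])
    next
      case True
      then have "B \<noteq> 0"
        using AB by simp
      \<comment> \<open>The system \<open>*\<close> is invariant under exchanging \<open>A\<close>
        and \<open>B\<close> while reversing the sign of \<open>d\<close>.\<close>
      with rank_one_relations[of A a "- d" B b] * show ?thesis
        by (simp add: algebra_simps)
    qed
  qed
  then have zero: "a = 0" "b = 0" "d = 0"
    by simp_all
  have RS: "c * R = 0" "c * S = 0" and PQ: "P * Q = 0" and Pc: "c * P = 0"
    using relation_5 relation_8 relation_6 relation_7 relation_1 relation_11 relation_18
      relation_19
    unfolding zero by algebra+
  have "P = 0 \<and> Q = 0 \<and> R = 0 \<and> S = 0"
  proof (cases "c = 0")
    case False
    then have "P = 0" "R = 0" "S = 0"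
      using RS Pc by simp_all
    \<comment> \<open>The remaining odd equations are here the products of \<open>Q\<close> with
      \<open>A\<close>, \<open>B\<close>, \<open>C\<close>, \<open>E\<close>, one of which is
      nonzero.\<close>
    moreover have "Q = 0"
      using jacobi_123_2 jacobi_125_2 jacobi_134_1 jacobi_145_1 \<open>\<not> (A = 0 \<and> B = 0 \<and> C = 0 \<and> E = 0)\<close>
      by (auto simp: zero \<open>P = 0\<close> \<open>R = 0\<close> \<open>S = 0\<close>)
    ultimately show ?thesis
      by simp
  next
    case True
    have P: "P = 0"
    proof (rule ccontr)
      assume P: "P \<noteq> 0"
      then have Q: "Q = 0"
        using PQ by simp
      then have t: "t = 0"
        using relation_10 P by simp
      have "q = 0" "r = 0"
        using relation_16 relation_17 P by (simp_all add: zero Q t)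
      moreover from this have "R = 0" "S = 0"
        using relation_12 relation_13 P by (simp_all add: Q)
      ultimately show False
        using relation_15 P by (simp add: zero Q t True)
    qed
    have Q: "Q = 0"
    proof (rule ccontr)
      assume Q: "Q \<noteq> 0"
      have "q = 0" "r = 0" "R = 0" "S = 0"
        using relation_5 relation_6 relation_12 relation_13 Q by (simp_all add: P True)
      then have "Q * (2 * t - 3 * Q) = 0" "Q * (3 * Q - 4 * t) = 0"
        using relation_4 relation_15 by (simp_all add: zero P True power2_eq_square algebra_simps)
      then show False
        using Q by simp
    qed
    have "R\<^sup>2 = 2 * (R * q)" "S\<^sup>2 = - 2 * (S * r)" "R * q + S * r = 0" "2 * (R * q) + S * r = 0"
      using relation_4 relation_9 relation_20 relation_15 by (simp_all add: zero P Q True)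
    then have "R\<^sup>2 = 0" "S\<^sup>2 = 0"
      by linarith+
    then show ?thesis
      using P Q by simp
  qed
  then show ?thesis
    using zero by simp
qed

text \<open>The split on \<open>c = 2 * a\<close> is natural because \<open>c - 2 * a\<close>
  multiplied by any of \<open>b\<close>, \<open>d\<close>, \<open>R\<close>, \<open>S\<close>
  vanishes. The families may overlap. In \<open>flat\<close> the four torsion parameters stay
  unrestricted, because that family is identified later from the torsion itself.\<close>

lemma symmetric_cases:
  assumes odd: "A = 0" "B = 0" "C = 0" "E = 0" "F = 0" "G = 0"
  obtains
    (flat) "a = 0" "b = 0" "d = 0" "P = 0" "Q = 0" "R = 0" "S = 0"
  | (semidirect) "a = 2 * Q" "c = 3 * Q" "t = 3 * Q" "Q \<noteq> 0"
      "b = 0" "d = 0" "P = 0" "R = 0" "S = 0" "q = 0" "r = 0"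
  | (so3_s2) "a \<noteq> 0" "c = 2 * a" "a * t = a\<^sup>2 + 3 * (b\<^sup>2 + d\<^sup>2)"
      "P = 0" "Q = 0" "R = 0" "S = 0" "q = 0" "r = 0"
  | (solvable_a) "b = 0" "d = 0" "P = 0" "Q = 0" "R = 0" "S = 0" "c = 0" "t = 0" "q = 0" "r = 0"
  | (solvable_P) "a = 0" "Q = 0" "R = 0" "S = 0" "c = 0" "t = 0" "q = 0" "r = 0"
  | (solvable_Q) "c = 2 * a" "2 * t = 2 * a + 3 * Q" "P = 0" "R = 0" "S = 0" "q = 0" "r = 0"
  | (solvable_R) "R = 2 * b" "S = 2 * d" "q = 2 * b" "r = - 2 * d"
      "a = 0" "P = 0" "Q = 0" "c = 0" "t = 0"
  | (solvable_R') "R = - 2 * b" "S = - 2 * d" "q = 0" "r = 0"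
      "a = 0" "P = 0" "Q = 0" "c = 0" "t = 0"
proof (cases "c = 2 * a")
  case False
  have "b = 0" "d = 0"
    using relation_2 relation_3 False by auto
  have "(c - 2 * a) * R = 0" "(c - 2 * a) * S = 0"
    using relation_5 relation_8 relation_6 relation_7 by algebra+
  then have "R = 0" "S = 0"
    using False by auto
  note z = \<open>b = 0\<close> \<open>d = 0\<close> \<open>R = 0\<close> \<open>S = 0\<close>
  have "P = 0"
  proof (rule ccontr)
    assume P: "P \<noteq> 0"
    then have "c = 0"
      using relation_14 by (simp add: z)
    then have "Q = 0"
      using relation_11 P by (simp add: z)
    then show False
      using relation_10 relation_12 relation_13 relation_15 P by (simp add: z \<open>c = 0\<close>)
  qed
  show ?thesis
  proof (cases "Q = 0")
    case Q: False
    then have q: "q = 0" "r = 0"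
      using relation_8 relation_7 by (simp_all add: z)
    have "Q * (2 * t - c - 3 * Q) = 0"
      using relation_4 by (simp add: z power2_eq_square algebra_simps)
    then have t: "2 * t = c + 3 * Q"
      using Q by simp
    have "(3 * Q - c) * (c - 2 * a) = 0"
      using relation_23 t unfolding odd z q by algebra
    then have c: "c = 3 * Q"
      using False by simp
    then have t: "t = 3 * Q"
      using t by simp
    have "6 * (Q * a) = 12 * (Q * Q)"
      using relation_15 by (simp add: z q c t \<open>P = 0\<close> power2_eq_square algebra_simps)
    then have "Q * (a - 2 * Q) = 0"
      by (simp add: algebra_simps)
    then show ?thesis
      using Q c t z q \<open>P = 0\<close> by (intro semidirect) simp_all
  next
    case Q: True
    have "2 * (a * t) = c * t"
      using relation_23 by (simp add: odd z Q)
    then have "(2 * a - c) * t = 0"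
      by algebra
    then have t: "t = 0"
      using False by simp
    then have "a * c = 0"
      using relation_15 by (simp add: z Q \<open>P = 0\<close>)
    show ?thesis
    proof (cases "a = 0")
      case True
      then show ?thesis
        using z Q \<open>P = 0\<close> by (intro flat) simp_all
    next
      case a: False
      then have "q = 0" "r = 0"
        using relation_16 relation_17 by (simp_all add: z Q t \<open>P = 0\<close>)
      then show ?thesis
        using z Q t \<open>P = 0\<close> \<open>a * c = 0\<close> a by (intro solvable_a) simp_all
    qed
  qed
next
  case c: True
  show ?thesis
  proof (cases "P = 0")
    case P: False
    have "P * (R - q) = 0" "P * (S + r) = 0"
      using relation_21 relation_16 relation_22 relation_17 unfolding odd c by algebra+
    then have q: "q = R" "r = - S"
      using P by simp_all
    \<comment> \<open>After the substitution, \<open>relation_12\<close> and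
      \<open>relation_13\<close> form a linear system in \<open>R\<close> and \<open>S\<close> whose
      determinant is, up to sign, the sum of the squares of \<open>P\<close> and
      \<open>Q\<close>.\<close>
    have "(P\<^sup>2 + Q\<^sup>2) * R = 0" "(P\<^sup>2 + Q\<^sup>2) * S = 0"
      using relation_12 relation_13 unfolding q by algebra+
    moreover have "P\<^sup>2 + Q\<^sup>2 \<noteq> 0"
      using P by (simp add: sum_power2_eq_zero_iff)
    ultimately have RS: "R = 0" "S = 0"
      by (simp_all only: mult_eq_0_iff simp_thms)
    then have "a = 0"
      using relation_14 P by (simp add: c)
    moreover from this have "Q = 0"
      using relation_11 P RS by (simp add: c)
    moreover from this have "t = 0"
      using relation_10 P by simp
    ultimately show ?thesis
      using RS q c by (intro solvable_P) simp_all
  next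
    case P: True
    have QRS: "Q * R = 0" "Q * S = 0"
      using relation_12 relation_13 by (simp_all add: P)
    show ?thesis
    proof (cases "Q = 0")
      case False
      then have RS: "R = 0" "S = 0"
        using QRS by simp_all
      then have q: "q = 0" "r = 0"
        using relation_8 relation_7 False by simp_all
      have "Q * (2 * t - 2 * a - 3 * Q) = 0"
        using relation_4 by (simp add: RS c power2_eq_square algebra_simps)
      then have "2 * t = 2 * a + 3 * Q"
        using False by simp
      then show ?thesis
        using c P RS q by (intro solvable_Q) simp_all
    next
      case Q: True
      show ?thesis
      proof (cases "R = 0 \<and> S = 0")
        case True
        then have RS: "R = 0" "S = 0"
          by simp_all
        have "b * q = 0" "a * q = 0" "a * r = 0"
          using relation_23 relation_17 relation_16 by (simp_all add: odd P Q RS c)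
        then have at: "a * t = a\<^sup>2 + 3 * (b\<^sup>2 + d\<^sup>2)"
          using relation_15 unfolding P Q RS c by algebra
        show ?thesis
        proof (cases "a = 0")
          case True
          then have "b\<^sup>2 + d\<^sup>2 = 0"
            using at by algebra
          then show ?thesis
            using True P Q RS by (intro flat) (simp_all add: sum_power2_eq_zero_iff)
        next
          case False
          then show ?thesis
            using \<open>a * q = 0\<close> \<open>a * r = 0\<close> at c P Q RS by (intro so3_s2) simp_all
        qed
      next
        case RS: False
        then have "a = 0"
          using relation_8 relation_7 by (auto simp: Q)
        then have "t = 0"
          using RS relation_16 relation_17 by (auto simp: P Q)
        have c0: "c = 0"
          using c \<open>a = 0\<close> by simp
        have q: "2 * q = R + 2 * b"
        proof (cases "R = 0")
          case True
          then show ?thesis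
            using RS relation_1 relation_14 by (simp add: P Q c0)
        next
          case False
          have "R * (R + 2 * b - 2 * q) = 0"
            using relation_4 by (simp add: Q power2_eq_square algebra_simps)
          then show ?thesis
            using False by simp
        qed
        have r: "2 * r = - (S + 2 * d)"
        proof (cases "R = 0")
          case True
          have "S * (S + 2 * d + 2 * r) = 0"
            using relation_9 by (simp add: Q power2_eq_square algebra_simps)
          then show ?thesis
            using RS True by simp
        next
          case False
          have "R * (S + 2 * d + 2 * r) = 0"
            using relation_11 by (simp add: P Q algebra_simps)
          then show ?thesis
            using False by simp
        qed
        have "R * q = 2 * (b * q)"
          using relation_23 by (auto simp: odd P Q c0 \<open>t = 0\<close> \<open>a = 0\<close>)
        then have "(R - 2 * b) * (R + 2 * b) = 0"
          using q by algebra
        moreover have "(S - 2 * d) * (S + 2 * d) = 0"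
          using \<open>R * q = 2 * (b * q)\<close> relation_20 r by algebra
        moreover have "S * b = R * d"
          using relation_14 by (simp add: P)
        \<comment> \<open>Each factorization leaves a sign open; \<open>S * b = R * d\<close> makes
          the two signs agree.\<close>
        ultimately consider "R = 2 * b" "S = 2 * d" | "R = - 2 * b" "S = - 2 * d"
          using RS by (auto simp: eq_neg_iff_add_eq_0 add.commute)
        then show ?thesis
        proof cases
          case 1
          then show ?thesis
            using q r P Q c0 \<open>t = 0\<close> \<open>a = 0\<close> by (intro solvable_R) simp_all
        next
          case 2
          then show ?thesis
            using q r P Q c0 \<open>t = 0\<close> \<open>a = 0\<close> by (intro solvable_R') simp_all
        qed
      qed
    qed
  qed
qed

section \<open>The algebras of symmetric pairs\<close>

lemma frame_bracket_span:
  assumes "br (f 1) (f 2) \<in> span V" "br (f 1) (f 3) \<in> span V" "br (f 1) (f 4) \<in> span V"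
      "br (f 1) (f 5) \<in> span V" "br (f 2) (f 3) \<in> span V" "br (f 2) (f 4) \<in> span V"
      "br (f 2) (f 5) \<in> span V" "br (f 3) (f 4) \<in> span V" "br (f 3) (f 5) \<in> span V" "br (f 4) (f 5) \<in> span V"
  shows "br (f i) (f j) \<in> span V"
proof (rule pairs_5[of "\<lambda>i j. br (f i) (f j) \<in> span V"])
  show "br (f j) (f i) \<in> span V" if "br (f i) (f j) \<in> span V" for i j
    using span_neg[OF that] lie_algebra_skew[OF lie, of "f j" "f i"] by simp
qed (use assms in \<open>auto simp: lie_algebra_self[OF lie] span_zero\<close>)

lemmas in_span = span_add span_diff span_neg span_scale span_zero

text \<open>\<open>br24\<close> is left out so that simplification uses the local fact expressing
  \<open>br (f 2) (f 4)\<close> through \<open>w\<close>.\<close>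

lemmas bracket_simps' = bracket_linear bracket_swap lie_algebra_self[OF lie]
  br12 br13 br14 br15 br23 br25 br34 br35 br45

section \<open>Derived series of the solvable families\<close>

lemma solvable_leaf_a:
  assumes "A = 0" "B = 0" "C = 0" "E = 0" "F = 0" "G = 0"
    and "b = 0" "d = 0" "P = 0" "Q = 0" "R = 0" "S = 0" "c = 0" "t = 0" "q = 0" "r = 0"
  shows "lie_solvable br"
proof (rule lie_solvableI[OF lie frame, of "{f 2, f 3, f 4, f 5}" "{}" "{}"])
  show "br (f i) (f j) \<in> span {f 2, f 3, f 4, f 5}" for i j
    by (rule frame_bracket_span) (auto simp: bracket_simps assms span_base intro!: in_span)
qed (auto simp: bracket_simps assms)

text \<open>In the remaining solvable cases the vector \<open>w\<close> spans the part of the derived algebra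
  lying in the plane of \<open>e\<^sub>2\<close> and \<open>e\<^sub>4\<close>.\<close>

lemma solvable_leaf_P:
  assumes "A = 0" "B = 0" "C = 0" "E = 0" "F = 0" "G = 0"
    and "a = 0" "Q = 0" "R = 0" "S = 0" "c = 0" "t = 0" "q = 0" "r = 0"
  shows "lie_solvable br"
proof -
  define w where "w = b *\<^sub>R f 2 + d *\<^sub>R f 4"
  have "br (f 2) (f 4) = - 2 *\<^sub>R w"
    by (simp add: bracket_simps assms w_def algebra_simps)
  moreover have "br w (f 3) \<in> span {f 3, f 5}" "br w (f 5) \<in> span {f 3, f 5}"
    by (auto simp: w_def bracket_simps assms span_base intro!: in_span)
  moreover have "br (f 3) w = - br w (f 3)" "br (f 5) w = - br w (f 5)"
    by (rule lie_algebra_skew[OF lie])+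
  ultimately show ?thesis
    by - (rule lie_solvableI[OF lie frame, of "{w, f 3, f 5}" "{f 3, f 5}" "{}"],
      rule frame_bracket_span; auto simp: bracket_simps' assms span_base intro!: in_span)
qed

lemma solvable_leaf_Q:
  assumes "A = 0" "B = 0" "C = 0" "E = 0" "F = 0" "G = 0"
    and "c = 2 * a" "2 * t = 2 * a + 3 * Q" "P = 0" "R = 0" "S = 0" "q = 0" "r = 0"
  shows "lie_solvable br"
proof -
  define w where "w = b *\<^sub>R f 2 + d *\<^sub>R f 4"
  \<comment> \<open>This value of \<open>t\<close> cancels \<open>br (f 1) (f 3)\<close> and
    \<open>br (f 1) (f 5)\<close>, so that \<open>f 1\<close>, \<open>f 3\<close>,
    \<open>f 5\<close> span a Heisenberg or Abelian subalgebra with \<open>f 1\<close> central in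
    it.\<close>
  have t: "t = a + 3/2 * Q"
    using assms by simp
  note zero = assms(1-7,9-) t
  have "br (f 2) (f 4) = (- 2/3 * a) *\<^sub>R f 1 - 2 *\<^sub>R w"
    by (simp add: bracket_simps zero w_def algebra_simps)
  moreover have "br w (f 3) \<in> span {f 1, f 3, f 5}" "br w (f 5) \<in> span {f 1, f 3, f 5}" "br w (f 1) = 0"
    by (auto simp: w_def bracket_simps zero span_base intro!: in_span)
  moreover have "br (f 3) w = - br w (f 3)" "br (f 5) w = - br w (f 5)" "br (f 1) w = - br w (f 1)"
    by (rule lie_algebra_skew[OF lie])+
  ultimately show ?thesis
    by - (rule lie_solvableI[OF lie frame, of "{f 1, w, f 3, f 5}" "{f 1, f 3, f 5}" "{f 1}"],
      rule frame_bracket_span; auto simp: bracket_simps' zero span_base intro!: in_span)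
qed

lemma solvable_leaf_R:
  assumes "A = 0" "B = 0" "C = 0" "E = 0" "F = 0" "G = 0"
    and "R = 2 * b" "S = 2 * d" "q = 2 * b" "r = - 2 * d"
      "a = 0" "P = 0" "Q = 0" "c = 0" "t = 0"
  shows "lie_solvable br"
proof -
  define w where "w = b *\<^sub>R f 2 + d *\<^sub>R f 4"
  have "br (f 2) (f 4) = - 2 *\<^sub>R w"
    by (simp add: bracket_simps assms w_def algebra_simps)
  moreover have "br w (f 3) \<in> span {f 3, f 5}" "br w (f 5) \<in> span {f 3, f 5}"
    by (auto simp: w_def bracket_simps assms span_base intro!: in_span)
  moreover have "br (f 3) w = - br w (f 3)" "br (f 5) w = - br w (f 5)"
    by (rule lie_algebra_skew[OF lie])+
  ultimately show ?thesis
    by - (rule lie_solvableI[OF lie frame, of "{w, f 3, f 5}" "{f 3, f 5}" "{}"],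
      rule frame_bracket_span; auto simp: bracket_simps' assms span_base intro!: in_span)
qed

lemma solvable_leaf_R':
  assumes "A = 0" "B = 0" "C = 0" "E = 0" "F = 0" "G = 0"
    and "R = - 2 * b" "S = - 2 * d" "q = 0" "r = 0"
      "a = 0" "P = 0" "Q = 0" "c = 0" "t = 0"
  shows "lie_solvable br"
proof -
  define w where "w = b *\<^sub>R f 2 + d *\<^sub>R f 4"
  have "br (f 2) (f 4) = - 2 *\<^sub>R w" "br (f 3) (f 5) = - 2 *\<^sub>R w"
    by (simp_all add: bracket_simps assms w_def algebra_simps)
  moreover have "br w (f 3) = 0" "br w (f 5) = 0"
    by (simp_all add: w_def bracket_simps assms mult.commute)
  moreover have "br (f 3) w = - br w (f 3)" "br (f 5) w = - br w (f 5)"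
    by (rule lie_algebra_skew[OF lie])+
  ultimately show ?thesis
    by - (rule lie_solvableI[OF lie frame, of "{w, f 3, f 5}" "{w}" "{}"],
      rule frame_bracket_span; auto simp: bracket_linear bracket_swap lie_algebra_self[OF lie]
        br12 br13 br14 br15 br23 br25 br34 br45 assms span_base intro!: in_span)
qed

text \<open>The degenerate member of the family \<open>so3_s2\<close>: only
  \<open>br (f 2) (f 4)\<close> and \<open>br (f 3) (f 5)\<close> can be nonzero, both multiples of
  the central vector \<open>f 1\<close>.\<close>

lemma heisenberg_leaf:
  assumes "A = 0" "B = 0" "C = 0" "E = 0" "F = 0" "G = 0"
    and "c = 2 * a" "t = a" "b = 0" "d = 0" "P = 0" "Q = 0" "R = 0" "S = 0" "q = 0" "r = 0"
  shows "lie_solvable br"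
proof (rule lie_solvableI[OF lie frame, of "{f 1}" "{}" "{}"])
  show "br (f i) (f j) \<in> span {f 1}" for i j
    by (rule frame_bracket_span) (auto simp: bracket_simps assms span_base intro!: in_span)
qed (auto simp: bracket_simps assms)

text \<open>The vectors \<open>f 1\<close>, \<open>f 2\<close>, \<open>f 4\<close> act on the plane
  of \<open>f 3\<close> and \<open>f 5\<close> as rotations of speeds \<open>- 3 * n / a\<close>,
  \<open>b\<close>, \<open>d\<close>. Both \<open>u\<close> and \<open>v\<close> are combinations of
  total speed zero, so they commute with the copy of \<ss>\<oo>(3) spanned by \<open>f 1\<close>,
  \<open>f 3\<close>, \<open>f 5\<close>.\<close>

lemma so3_s2_leaf:
  assumes "A = 0" "B = 0" "C = 0" "E = 0" "F = 0" "G = 0"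
    and "a \<noteq> 0" "c = 2 * a" "a * t = a\<^sup>2 + 3 * (b\<^sup>2 + d\<^sup>2)"
      "P = 0" "Q = 0" "R = 0" "S = 0" "q = 0" "r = 0" and nz: "b \<noteq> 0 \<or> d \<noteq> 0"
  shows "iso_so3_plus_s2 br"
proof -
  define n where "n = b\<^sup>2 + d\<^sup>2"
  have n: "n > 0"
    using nz by (simp add: n_def sum_power2_gt_zero_iff)
  have t: "t = a + 3 * n / a"
    using assms(7,9) by (simp add: n_def field_simps power2_eq_square)
  note zero = assms(1-6,8,10-15) t
  \<comment> \<open>\<open>v\<close> is minus one half of \<open>br (f 2) (f 4)\<close>, and the
    factor in \<open>u\<close> is chosen so that \<open>br u v\<close> is exactly
    \<open>- v\<close>.\<close>
  define v where "v = (a / 3) *\<^sub>R f 1 + b *\<^sub>R f 2 + d *\<^sub>R f 4"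
  define u where "u = (1 / (2 * n)) *\<^sub>R (d *\<^sub>R f 2 - b *\<^sub>R f 4)"
  have "br (f 3) (f 5) = (- t / 3) *\<^sub>R f 1"
    by (simp add: bracket_simps assms(1-6,10-15))
  moreover have "br (f 1) (f 3) = (- 3 * n / a) *\<^sub>R f 5" "br (f 5) (f 1) = (- 3 * n / a) *\<^sub>R f 3"
    by (simp_all add: bracket_simps zero)
  ultimately have bracket: "br (f 1) (f 3) = (- 3 * n / a) *\<^sub>R f 5"
    "br (f 3) (f 5) = (- t / 3) *\<^sub>R f 1" "br (f 5) (f 1) = (- 3 * n / a) *\<^sub>R f 3"
    by blast+
  have zero_u: "br (f 1) u = 0" "br (f 3) u = 0" "br (f 5) u = 0"
    by (simp_all add: u_def bracket_simps zero mult.commute)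
  have zero_v: "br (f 1) v = 0" "br (f 3) v = 0" "br (f 5) v = 0"
  proof -
    have "br (f 3) v = (n - (b * b + d * d)) *\<^sub>R f 5" "br (f 5) v = ((b * b + d * d) - n) *\<^sub>R f 3"
      using assms(7) by (simp_all add: v_def bracket_simps zero algebra_simps)
    then show "br (f 3) v = 0" "br (f 5) v = 0"
      by (simp_all add: n_def power2_eq_square)
    show "br (f 1) v = 0"
      by (simp add: v_def bracket_simps zero)
  qed
  have uv: "br u v = - 1 *\<^sub>R v"
  proof -
    have "br u v = ((b * b + d * d) / (2 * n)) *\<^sub>R br (f 2) (f 4)"
      by (simp add: u_def v_def bracket_linear bracket_swap lie_algebra_self[OF lie] br12 br14 zero
          algebra_simps diff_divide_distrib add_divide_distrib)
    also have "\<dots> = (1 / 2) *\<^sub>R br (f 2) (f 4)"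
      using n by (simp add: n_def power2_eq_square)
    also have "\<dots> = - 1 *\<^sub>R v"
      by (simp add: v_def br24 zero algebra_simps)
    finally show ?thesis .
  qed
  let ?s = "span {f 1, f 3, f 5, u, v}"
  have s: "f 1 \<in> ?s" "f 3 \<in> ?s" "f 5 \<in> ?s" "u \<in> ?s" "v \<in> ?s"
    by (simp_all add: span_base)
  have nd: "n = b * b + d * d"
    by (simp add: n_def power2_eq_square)
  have u': "(2 * n) *\<^sub>R u = d *\<^sub>R f 2 - b *\<^sub>R f 4"
    using n by (simp add: u_def)
  have "n *\<^sub>R f 2 = b *\<^sub>R (v - (a / 3) *\<^sub>R f 1) + d *\<^sub>R (2 * n) *\<^sub>R u"
    "n *\<^sub>R f 4 = d *\<^sub>R (v - (a / 3) *\<^sub>R f 1) - b *\<^sub>R (2 * n) *\<^sub>R u"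
    unfolding u' by (simp_all add: v_def nd algebra_simps)
  then have "n *\<^sub>R f 2 \<in> ?s" "n *\<^sub>R f 4 \<in> ?s"
    using s by (metis in_span)+
  then have "(1 / n) *\<^sub>R n *\<^sub>R f 2 \<in> ?s" "(1 / n) *\<^sub>R n *\<^sub>R f 4 \<in> ?s"
    by (auto intro: span_scale simp del: scaleR_scaleR)
  then have "f i \<in> ?s" for i
    using exhaust_5[of i] n s by auto
  moreover have "- t / 3 * (- 3 * n / a) > 0" "- 3 * n / a * (- 3 * n / a) > 0"
  proof -
    have "- t / 3 * (- 3 * n / a) = n * (1 + 3 * n / a\<^sup>2)"
      using assms(7) by (simp add: t field_simps power2_eq_square)
    moreover have "- 3 * n / a * (- 3 * n / a) = (3 * n / a)\<^sup>2"
      by (simp add: power2_eq_square)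
    ultimately show "- t / 3 * (- 3 * n / a) > 0" "- 3 * n / a * (- 3 * n / a) > 0"
      using n assms(7) by (auto intro!: mult_pos_pos add_pos_nonneg)
  qed
  ultimately have "lie_isomorphic br (so3 \<times> UNIV)
    (sum_bracket commutator (\<lambda>X Y. - vector [0, 1 * wedge 1 2 X Y]) :: (real^3^3) \<times> (real^2) \<Rightarrow> _)"
    by (rule lie_isomorphic_so3_plus[OF lie frame _ _ _ bracket zero_u zero_v uv])
  then show ?thesis
    by (simp add: iso_so3_plus_s2_def s2_bracket_def[abs_def])
qed

lemma l2_leaf:
  assumes "A = 0" "B = 0" "C = 0" "E = 0" "F = 0" "G = 0"
    and "a = 2 * Q" "c = 3 * Q" "t = 3 * Q" "Q \<noteq> 0"
      "b = 0" "d = 0" "P = 0" "R = 0" "S = 0" "q = 0" "r = 0"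
  shows "iso_l2 br"
proof -
  \<comment> \<open>\<open>f 1 - f 4\<close> and \<open>f 1 + f 4\<close> are eigenvectors of the
    adjoint action of \<open>f 2\<close>, with eigenvalues \<open>Q\<close> and \<open>- Q\<close>,
    while \<open>f 3\<close> and \<open>f 5\<close> have \<open>Q / 2\<close> and
    \<open>- Q / 2\<close>. The factor \<open>2 / Q\<close> makes these the weights 2, -2, 1,
    -1.\<close>
  define g where "g = ($) (vector [(1 / Q) *\<^sub>R (f 1 - f 4), (2 / Q) *\<^sub>R f 2, f 3,
    (1 / Q) *\<^sub>R (f 1 + f 4), f 5] :: 'l^5)"
  have g: "g 1 = (1 / Q) *\<^sub>R (f 1 - f 4)" "g 2 = (2 / Q) *\<^sub>R f 2" "g 3 = f 3"
    "g 4 = (1 / Q) *\<^sub>R (f 1 + f 4)" "g 5 = f 5"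
    by (simp_all only: g_def vector_5)
  let ?s = "span (range g)"
  have s: "g i \<in> ?s" for i
    by (simp add: span_base)
  have "f 1 = (Q / 2) *\<^sub>R (g 1 + g 4)" "f 2 = (Q / 2) *\<^sub>R g 2" "f 3 = g 3"
    "f 4 = (Q / 2) *\<^sub>R (g 4 - g 1)" "f 5 = g 5"
    using assms(10) by (simp_all add: g algebra_simps flip: scaleR_left_distrib)
  then have "f i \<in> ?s" for i
    using exhaust_5[of i] s in_span by metis
  then have frame_g: "is_frame g"
    by (rule is_frame_spanI[OF frame])
  show ?thesis
    by (rule iso_l2I[OF lie frame_g])
      (use assms(10) in \<open>simp_all add: g bracket_simps assms(1-9,11-) algebra_simps flip: scaleR_left_distrib\<close>)
qed

end

section \<open>The characteristic connection in the adapted frame\<close>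

lemma frame_metric_basis:
  assumes "is_frame e"
  shows "frame_metric e X (e k) = coframe e k X" "frame_metric e (e k) X = coframe e k X"
  by (simp_all add: frame_metric_def coframe_basis[OF assms] if_distrib[of "\<lambda>t. _ * t"] if_distrib[of "\<lambda>t. t * _"]
      cong: if_cong)

lemma symmetric_3_tensor_polarization:
  assumes "symmetric_3_tensor U"
  shows "6 * U X Y Z = U (X + Y + Z) (X + Y + Z) (X + Y + Z) - U (X + Y) (X + Y) (X + Y)
    - U (Y + Z) (Y + Z) (Y + Z) - U (X + Z) (X + Z) (X + Z) + U X X X + U Y Y Y + U Z Z Z"
proof -
  have sym: "U X Y Z = U Y X Z" "U X Y Z = U X Z Y" and lin: "linear (\<lambda>X. U X Y Z)" for X Y Z
    using assms by (auto simp: symmetric_3_tensor_def)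
  have 1: "U (X + X') Y Z = U X Y Z + U X' Y Z" for X X' Y Z
    using linear_add[OF lin] by simp
  have 2: "U X (Y + Y') Z = U X Y Z + U X Y' Z" for X Y Y' Z
    using 1 sym(1) by metis
  have 3: "U X Y (Z + Z') = U X Y Z + U X Y Z'" for X Y Z Z'
    using 2 sym(2) by metis
  have "U Y X Z = U X Y Z" "U X Z Y = U X Y Z" "U Z X Y = U X Y Z" "U Y Z X = U X Y Z" "U Z Y X = U X Y Z"
    "U Y X X = U X X Y" "U X Y X = U X X Y" "U Z X X = U X X Z" "U X Z X = U X X Z"
    "U X Y Y = U Y Y X" "U Y X Y = U Y Y X" "U Z Y Y = U Y Y Z" "U Y Z Y = U Y Y Z"
    "U X Z Z = U Z Z X" "U Z X Z = U Z Z X" "U Y Z Z = U Z Z Y" "U Z Y Z = U Z Z Y"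
    using sym by metis+
  then show ?thesis
    by (simp add: 1 2 3)
qed

text \<open>A symmetric tensor is recovered from its cubic form by polarization. The operator
  \<open>pol\<close> is linear and sends a product of three coordinates to the sum over the six ways
  of distributing \<open>X\<close>, \<open>Y\<close>, \<open>Z\<close>, so each monomial can be
  polarized separately.\<close>

lemma so3_structure_tensor:
  assumes "so3_structure e g U"
    and x: "\<And>i. x i = coframe e i X" "\<And>i. y i = coframe e i Y" "\<And>i. z i = coframe e i Z"
  shows "U X Y Z = (x 1 * y 2 * z 2 + x 2 * y 1 * z 2 + x 2 * y 2 * z 1)
    + (x 1 * y 4 * z 4 + x 4 * y 1 * z 4 + x 4 * y 4 * z 1) - x 1 * y 1 * z 1
    - 1/2 * (x 1 * y 3 * z 3 + x 3 * y 1 * z 3 + x 3 * y 3 * z 1)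
    - 1/2 * (x 1 * y 5 * z 5 + x 5 * y 1 * z 5 + x 5 * y 5 * z 1)
    + sqrt 3 / 2 * ((x 4 * y 5 * z 5 + x 5 * y 4 * z 5 + x 5 * y 5 * z 4)
      - (x 4 * y 3 * z 3 + x 3 * y 4 * z 3 + x 3 * y 3 * z 4)
      + (x 2 * y 3 * z 5 + x 2 * y 5 * z 3 + x 3 * y 2 * z 5 + x 5 * y 2 * z 3
        + x 3 * y 5 * z 2 + x 5 * y 3 * z 2))"
proof -
  have e: "is_frame e" and "symmetric_3_tensor U" and cubic: "\<And>X. U X X X = so3_cubic e X"
    using assms by (auto simp: so3_structure_def)
  define pol where "pol m = m (X + Y + Z) - m (X + Y) - m (Y + Z) - m (X + Z) + m X + m Y + m Z"
    for m :: "'a \<Rightarrow> real"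
  have pol_prod: "pol (\<lambda>X. coframe e i X * coframe e j X * coframe e k X) =
    x i * y j * z k + x i * y k * z j + x j * y i * z k + x j * y k * z i + x k * y i * z j + x k * y j * z i"
    for i j k
    by (simp add: pol_def coframe_add[OF e] x algebra_simps)
  have pol_lin: "pol (\<lambda>X. m X + n X) = pol m + pol n" "pol (\<lambda>X. r * m X) = r * pol m" for m n r
    by (simp_all add: pol_def algebra_simps)
  have cubic': "U X X X = - 1 * (coframe e 1 X * coframe e 1 X * coframe e 1 X)
    + (3 * (coframe e 1 X * coframe e 2 X * coframe e 2 X) + (3 * (coframe e 1 X * coframe e 4 X * coframe e 4 X)
    + (- 3/2 * (coframe e 1 X * coframe e 3 X * coframe e 3 X) + (- 3/2 * (coframe e 1 X * coframe e 5 X * coframe e 5 X)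
    + (3/2 * sqrt 3 * (coframe e 4 X * coframe e 5 X * coframe e 5 X)
    + (- 3/2 * sqrt 3 * (coframe e 4 X * coframe e 3 X * coframe e 3 X)
    + 3 * sqrt 3 * (coframe e 2 X * coframe e 3 X * coframe e 5 X)))))))" for X
    unfolding cubic so3_cubic_def Let_def by (simp add: power2_eq_square field_simps)
  have "6 * U X Y Z = pol (\<lambda>X. U X X X)"
    using symmetric_3_tensor_polarization[OF \<open>symmetric_3_tensor U\<close>, of X Y Z] by (simp add: pol_def)
  then show ?thesis
    unfolding cubic' pol_lin pol_prod by (simp add: field_simps)
qed

lemma span_124:
  assumes "is_frame e" and "X \<in> span {e 1, e 2, e 4}"
  shows "coframe e 3 X = 0" "coframe e 5 X = 0"
proof -
  have "coframe e k Z = 0" if "k = 3 \<or> k = 5" "Z \<in> span {e 1, e 2, e 4}" for k Z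
    using that(2)
    by (rule linear_eq_0_on_span[OF linear_coframe[OF assms(1)], rotated])
      (use that(1) in \<open>auto simp: coframe_basis[OF assms(1)] distinct_5\<close>)
  then show "coframe e 3 X = 0" "coframe e 5 X = 0"
    using assms(2) by auto
qed

lemma span_35:
  assumes "is_frame e" and "X \<in> span {e 3, e 5}"
  shows "coframe e 1 X = 0" "coframe e 2 X = 0" "coframe e 4 X = 0"
proof -
  have "coframe e k Z = 0" if "k = 1 \<or> k = 2 \<or> k = 4" "Z \<in> span {e 3, e 5}" for k Z
    using that(2)
    by (rule linear_eq_0_on_span[OF linear_coframe[OF assms(1)], rotated])
      (use that(1) in \<open>auto simp: coframe_basis[OF assms(1)] distinct_5\<close>)
  then show "coframe e 1 X = 0" "coframe e 2 X = 0" "coframe e 4 X = 0"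
    using assms(2) by auto
qed

text \<open>The stabilizer of the cubic form is the irreducible \<open>\<ss>\<oo>(3) \<subset> \<ss>\<oo>(5)\<close>. It is three-dimensional, so
  the ten components of a skew endomorphism satisfy seven linear relations.\<close>

lemma connection_relations:
  assumes str: "so3_structure e g U" and con: "characteristic_connection br g U D"
    and \<Gamma>: "\<And>j k. \<Gamma> j k = coframe e k (D X (e j))"
  shows "\<Gamma> j k = - \<Gamma> k j" and "\<Gamma> 1 2 = 0" "\<Gamma> 1 4 = 0" "\<Gamma> 1 3 = sqrt 3 * \<Gamma> 2 5" "\<Gamma> 1 5 = sqrt 3 * \<Gamma> 2 3"
    "\<Gamma> 1 5 = sqrt 3 * \<Gamma> 4 5" "\<Gamma> 1 3 = sqrt 3 * \<Gamma> 3 4" "\<Gamma> 2 4 = 2 * \<Gamma> 3 5"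
proof -
  have e: "is_frame e" and g: "g = frame_metric e"
    using str by (auto simp: so3_structure_def)
  have con2: "cov_deriv_2 D g X Y Z = 0" and con3: "cov_deriv_3 D U X Y Z W = 0" for Y Z W
    using con by (auto simp: characteristic_connection_def)
  show skew: "\<Gamma> j k = - \<Gamma> k j" for j k
    using con2[of "e j" "e k"] by (simp add: cov_deriv_2_def g frame_metric_basis[OF e] \<Gamma>)
  have diag: "\<Gamma> j j = 0" for j
    using skew[of j j] by simp
  have con3': "U (D X (e j)) (e k) (e l) + U (e j) (D X (e k)) (e l) + U (e j) (e k) (D X (e l)) = 0" for j k l
    using con3[of "e j" "e k" "e l"] by (simp add: cov_deriv_3_def)
  note expand = so3_structure_tensor[OF str refl refl refl] coframe_basis[OF e] distinct_5 refl if_True if_False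
    \<Gamma>[symmetric] diag
  show 12: "\<Gamma> 1 2 = 0"
    using con3'[of 1 1 2] skew[of 2 1] by (simp add: expand)
  show 14: "\<Gamma> 1 4 = 0"
    using con3'[of 1 1 4] skew[of 4 1] by (simp add: expand)
  show "\<Gamma> 1 3 = sqrt 3 * \<Gamma> 2 5"
    using con3'[of 2 2 3] skew[of 3 1] by (simp add: expand)
  show "\<Gamma> 1 5 = sqrt 3 * \<Gamma> 2 3"
    using con3'[of 2 2 5] skew[of 5 1] by (simp add: expand)
  show "\<Gamma> 1 5 = sqrt 3 * \<Gamma> 4 5"
    using con3'[of 4 4 5] skew[of 5 1] by (simp add: expand)
  show "\<Gamma> 1 3 = sqrt 3 * \<Gamma> 3 4"
    using con3'[of 4 4 3] skew[of 3 1] skew[of 4 3] by (simp add: expand)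
  have "sqrt 3 * (\<Gamma> 2 4 - 2 * \<Gamma> 3 5) = 0"
    using con3'[of 2 3 3] skew[of 2 1] 12 by (simp add: expand algebra_simps)
  then show "\<Gamma> 2 4 = 2 * \<Gamma> 3 5"
    by simp
qed


text \<open>The torsion formula gives each component of the bracket from \<Gamma> and
  \<open>t\<close>. The second conclusion holds because the seven parameters are, up to an
  invertible linear change, all the components of \<Gamma> that the stabilizer and the splitting
  leave free.\<close>

lemma so3_structure_bracket:
  fixes br :: "'l::real_vector \<Rightarrow> 'l \<Rightarrow> 'l" and e :: "5 \<Rightarrow> 'l"
  assumes lie: "lie_algebra br" and str: "so3_structure e g U"
    and con: "characteristic_connection br g U D" and T: "T = torsion br g D"
    and h: "h = span {e 1, e 2, e 4}" and p: "p = span {e 3, e 5}"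
    and D_h: "\<forall>X\<in>h. (\<forall>Z\<in>h. D X Z \<in> h) \<and> (\<forall>Z\<in>p. D X Z \<in> p)"
    and D_p: "\<forall>Y\<in>p. (\<forall>Z\<in>h. D Y Z \<in> p) \<and> (\<forall>Z\<in>p. D Y Z \<in> h)"
  obtains P Q R S a b d where
    "so3_bracket br (e(1 := sqrt 3 *\<^sub>R e 1)) P Q R S a b d
      (sqrt 3 * T (e 1) (e 2) (e 4)) (sqrt 3 * T (e 1) (e 3) (e 5)) (T (e 2) (e 3) (e 5)) (T (e 3) (e 4) (e 5))
      (sqrt 3 * T (e 1) (e 2) (e 3)) (sqrt 3 * T (e 1) (e 2) (e 5)) (sqrt 3 * T (e 1) (e 3) (e 4))
      (sqrt 3 * T (e 1) (e 4) (e 5)) (T (e 2) (e 3) (e 4)) (T (e 2) (e 4) (e 5))"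
    "a = 0 \<Longrightarrow> b = 0 \<Longrightarrow> d = 0 \<Longrightarrow> P = 0 \<Longrightarrow> Q = 0 \<Longrightarrow> R = 0 \<Longrightarrow> S = 0 \<Longrightarrow> \<forall>i j. D (e i) (e j) = 0"
proof -
  define s :: real where "s = sqrt 3"
  have s: "s * s = 3" and s0: "s \<noteq> 0"
    by (simp_all add: s_def)
  have e: "is_frame e" and g: "g = frame_metric e"
    using str by (auto simp: so3_structure_def)
  define \<Gamma> where "\<Gamma> i j k = coframe e k (D (e i) (e j))" for i j k
  define t where "t i j k = T (e i) (e j) (e k)" for i j k
  note rel = connection_relations[OF str con, where \<Gamma> = "\<Gamma> _", OF \<Gamma>_def, folded s_def]
  have t_eq: "t i j k = \<Gamma> i j k - \<Gamma> j i k - coframe e k (br (e i) (e j))" for i j k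
    by (simp add: t_def T torsion_def g frame_metric_basis[OF e] coframe_diff[OF e] \<Gamma>_def)
  have c: "coframe e k (br (e i) (e j)) = \<Gamma> i j k - \<Gamma> j i k - t i j k" for i j k
    by (simp add: t_eq)
  have "totally_skew T"
    using con T by (simp add: characteristic_connection_def)
  then have skew: "t i j k = - t j i k" "t i j k = - t i k j" for i j k
    unfolding totally_skew_def t_def by blast+
  have zero: "t i i k = 0" "t i k k = 0" "t i k i = 0" for i k
    using skew(1)[of i i k] skew(2)[of i k k] skew(1)[of i k i] skew(2)[of k i i] by simp_all
  have perm: "t 1 3 2 = - t 1 2 3" "t 1 4 2 = - t 1 2 4" "t 1 5 2 = - t 1 2 5" "t 1 4 3 = - t 1 3 4"
    "t 1 5 3 = - t 1 3 5" "t 1 5 4 = - t 1 4 5" "t 2 4 3 = - t 2 3 4" "t 2 5 3 = - t 2 3 5"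
    "t 2 5 4 = - t 2 4 5" "t 3 5 4 = - t 3 4 5"
    "t 2 3 1 = t 1 2 3" "t 2 4 1 = t 1 2 4" "t 2 5 1 = t 1 2 5" "t 3 4 1 = t 1 3 4" "t 3 5 1 = t 1 3 5"
    "t 4 5 1 = t 1 4 5" "t 3 4 2 = t 2 3 4" "t 3 5 2 = t 2 3 5" "t 4 5 2 = t 2 4 5" "t 4 5 3 = t 3 4 5"
    using skew by metis+
  have in_h: "e 1 \<in> h" "e 2 \<in> h" "e 4 \<in> h" and in_p: "e 3 \<in> p" "e 5 \<in> p"
    by (simp_all add: h p span_base)
  \<comment> \<open>The components 23 and 25 of \<Gamma> are the coordinates on the two stabilizer
    generators exchanging \<h> and \<p>, and 35 is the coordinate on the generator preserving them.
    The former vanish along \<h>, the latter along \<p>.\<close>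
  have split: "\<Gamma> i 2 5 = 0" "\<Gamma> i 2 3 = 0" if "i = 1 \<or> i = 2 \<or> i = 4" for i
    using that D_h in_h span_124[OF e] by (auto simp: \<Gamma>_def h)
  have split': "\<Gamma> i 3 5 = 0" if "i = 3 \<or> i = 5" for i
    using that D_p in_p span_124[OF e] by (auto simp: \<Gamma>_def h)
  have diag: "\<Gamma> i j j = 0" for i j
    using rel(1)[of i j j] by simp
  have swap: "\<Gamma> i 2 1 = - \<Gamma> i 1 2" "\<Gamma> i 3 1 = - \<Gamma> i 1 3" "\<Gamma> i 4 1 = - \<Gamma> i 1 4" "\<Gamma> i 5 1 = - \<Gamma> i 1 5"
    "\<Gamma> i 3 2 = - \<Gamma> i 2 3" "\<Gamma> i 4 2 = - \<Gamma> i 2 4" "\<Gamma> i 5 2 = - \<Gamma> i 2 5" "\<Gamma> i 4 3 = - \<Gamma> i 3 4"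
    "\<Gamma> i 5 3 = - \<Gamma> i 3 5" "\<Gamma> i 5 4 = - \<Gamma> i 4 5" for i
    by (rule rel(1))+
  have conn: "\<Gamma> i 1 2 = 0" "\<Gamma> i 1 4 = 0" "\<Gamma> i 1 3 = s * \<Gamma> i 2 5" "\<Gamma> i 1 5 = s * \<Gamma> i 2 3"
    "\<Gamma> i 4 5 = \<Gamma> i 2 3" "\<Gamma> i 3 4 = \<Gamma> i 2 5" "\<Gamma> i 2 4 = 2 * \<Gamma> i 3 5" for i
    using rel(2-8)[of i] s0 by auto
  note table = swap diag conn split split' zero perm
  define a where "a = s * \<Gamma> 1 3 5"
  define b where "b = \<Gamma> 2 3 5"
  define d where "d = \<Gamma> 4 3 5"
  define P where "P = - \<Gamma> 3 2 5 - \<Gamma> 5 2 3"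
  define Q where "Q = - \<Gamma> 3 2 3 + \<Gamma> 5 2 5"
  define R where "R = - \<Gamma> 3 2 5 + \<Gamma> 5 2 3"
  define S where "S = - \<Gamma> 5 2 5 - \<Gamma> 3 2 3"
  note params = a_def b_def d_def P_def Q_def R_def S_def
  define f where "f = e(1 := s *\<^sub>R e 1)"
  have f: "f 1 = s *\<^sub>R e 1" "f 2 = e 2" "f 3 = e 3" "f 4 = e 4" "f 5 = e 5"
    by (simp_all add: f_def)
  have "e i \<in> span (range f)" for i
  proof -
    have "e 1 = (1 / s) *\<^sub>R f 1"
      using s0 by (simp add: f)
    moreover have "f i \<in> span (range f)" for i
      by (simp add: span_base)
    ultimately show ?thesis
      using exhaust_5[of i] f span_scale by metis
  qed
  then have frame_f: "is_frame f"
    by (rule is_frame_spanI[OF e])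
  have eqI: "X = Y" if "coframe e 1 X = coframe e 1 Y" "coframe e 2 X = coframe e 2 Y"
    "coframe e 3 X = coframe e 3 Y" "coframe e 4 X = coframe e 4 Y" "coframe e 5 X = coframe e 5 Y" for X Y
    using that frame_eqI[OF e, of X Y] forall_5[of "\<lambda>i. coframe e i X = coframe e i Y"] by blast
  have s': "s * (s * x) = 3 * x" for x
    using s by (simp flip: mult.assoc)
  have "so3_bracket br f P Q R S a b d (s * t 1 2 4) (s * t 1 3 5) (t 2 3 5) (t 3 4 5)
    (s * t 1 2 3) (s * t 1 2 5) (s * t 1 3 4) (s * t 1 4 5) (t 2 3 4) (t 2 4 5)"
  proof (unfold_locales, rule lie, rule frame_f)
  qed (rule eqI; simp add: f bilinear_simps[OF lie_algebra_bilinear[OF lie]] c coframe_simps[OF e] distinct_5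
            table params s s'; simp add: field_simps s s')+
  moreover have "\<forall>i j. D (e i) (e j) = 0"
    if "a = 0" "b = 0" "d = 0" "P = 0" "Q = 0" "R = 0" "S = 0"
  proof -
    have z: "\<Gamma> 1 3 5 = 0" "\<Gamma> 2 3 5 = 0" "\<Gamma> 4 3 5 = 0" "\<Gamma> 3 2 5 = 0" "\<Gamma> 5 2 3 = 0" "\<Gamma> 3 2 3 = 0" "\<Gamma> 5 2 5 = 0"
      using that s0 by (auto simp: params)
    have "\<Gamma> i 3 5 = 0" "\<Gamma> i 2 3 = 0" "\<Gamma> i 2 5 = 0" for i
      using exhaust_5[of i] z split split' by auto
    then have "\<forall>j k. \<Gamma> i j k = 0" for i
      unfolding forall_5 by (simp add: swap diag conn)
    then show ?thesis
      by (auto intro!: frame_eqI[OF e] simp: coframe_zero[OF e] simp flip: \<Gamma>_def)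
  qed
  ultimately show thesis
    by (intro that[of P Q R S a b d]) (simp_all add: f_def s_def t_def)
qed

section \<open>The Hodge star\<close>

lemma linear_eq_0_on_frame:
  assumes "is_frame f" and "linear L" and "\<And>i. L (f i) = 0"
  shows "L X = 0"
  by (rule linear_eq_0_on_span[OF assms(2), of "range f"]) (use assms in \<open>auto simp: is_frame_def\<close>)

section \<open>The volume form on permuted and repeated arguments\<close>

lemma volume_form_permute:
  assumes "p permutes UNIV"
  shows "volume_form e (\<chi> j. v $ p j) = of_int (sign p) * volume_form e v"
  using det_permute_columns[OF assms, of "(\<chi> i j. coframe e i (v $ j)) :: real^5^5"]
  by (simp add: volume_form_def)

lemma vector_5_swap:
  "(vector [y, x, z, u, v] :: 'a::zero^5) = (\<chi> j. vector [x, y, z, u, v] $ Transposition.transpose 1 2 j)"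
  "(vector [x, z, y, u, v] :: 'a^5) = (\<chi> j. vector [x, y, z, u, v] $ Transposition.transpose 2 3 j)"
  "(vector [x, y, z, v, u] :: 'a^5) = (\<chi> j. vector [x, y, z, u, v] $ Transposition.transpose 4 5 j)"
  unfolding vec_eq_iff forall_5 vec_lambda_beta Transposition.transpose_def by (simp_all add: vector_5)

lemma volume_form_swap:
  "volume_form e (vector [y, x, z, u, v]) = - volume_form e (vector [x, y, z, u, v])"
  "volume_form e (vector [x, z, y, u, v]) = - volume_form e (vector [x, y, z, u, v])"
  "volume_form e (vector [x, y, z, v, u]) = - volume_form e (vector [x, y, z, u, v])"
proof -
  have swap: "volume_form e (\<chi> j. w $ Transposition.transpose a b j) = - volume_form e w" if "a \<noteq> b" for a b w
    using volume_form_permute[OF permutes_swap_id[of a UNIV b], of e w] that by (simp add: sign_swap_id)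
  show "volume_form e (vector [y, x, z, u, v]) = - volume_form e (vector [x, y, z, u, v])"
    unfolding vector_5_swap(1)[of y x] by (rule swap) (rule distinct_5)
  show "volume_form e (vector [x, z, y, u, v]) = - volume_form e (vector [x, y, z, u, v])"
    unfolding vector_5_swap(2)[of x z y] by (rule swap) (rule distinct_5)
  show "volume_form e (vector [x, y, z, v, u]) = - volume_form e (vector [x, y, z, u, v])"
    unfolding vector_5_swap(3)[of x y z v u] by (rule swap) (rule distinct_5)
qed

lemma volume_form_repeat:
  assumes "j \<noteq> k" and "v $ j = v $ k"
  shows "volume_form e v = 0"
  unfolding volume_form_def
  by (rule det_identical_columns[OF assms(1)]) (simp add: column_def assms(2))

lemma volume_form_frame:
  assumes "is_frame e" and "p permutes UNIV"
  shows "volume_form e (\<chi> j. e (p j)) = of_int (sign p)"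
proof -
  have "volume_form e (\<chi> j. e j) = det (mat 1 :: real^5^5)"
    unfolding volume_form_def by (rule arg_cong[of _ _ det]) (simp add: vec_eq_iff mat_def coframe_basis[OF assms(1)])
  then show ?thesis
    using volume_form_permute[OF assms(2), of e "\<chi> j. e j"] by simp
qed

lemma volume_form_linear:
  assumes "is_frame e"
  shows "linear (\<lambda>X. volume_form e (vector [x, y, z, X, u]))"
proof -
  have *: "volume_form e (vector [x, y, z, X, u]) = det ((\<chi> i. if i = 4 then (\<chi> k. coframe e k X)
      else (\<chi> k. coframe e k (vector [x, y, z, 0, u] $ i))) :: real^5^5)" for X
  proof -
    have "volume_form e (vector [x, y, z, X, u]) = det (transpose ((\<chi> i j. coframe e i (vector [x, y, z, X, u] $ j)) :: real^5^5))"
      by (simp add: volume_form_def)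
    also have "transpose ((\<chi> i j. coframe e i (vector [x, y, z, X, u] $ j)) :: real^5^5) =
      (\<chi> i. if i = 4 then (\<chi> k. coframe e k X) else (\<chi> k. coframe e k (vector [x, y, z, 0, u] $ i)))"
      unfolding vec_eq_iff transpose_def vec_lambda_beta forall_5 by (simp add: vector_5)
    finally show ?thesis .
  qed
  show ?thesis
  proof (rule linearI)
    fix X Y :: 'a and r :: real
    show "volume_form e (vector [x, y, z, X + Y, u]) =
      volume_form e (vector [x, y, z, X, u]) + volume_form e (vector [x, y, z, Y, u])"
      unfolding * det_row_add[symmetric]
      by (rule arg_cong[of _ _ det]) (simp add: vec_eq_iff coframe_add[OF assms])
    show "volume_form e (vector [x, y, z, r *\<^sub>R X, u]) = r *\<^sub>R volume_form e (vector [x, y, z, X, u])"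
      unfolding * real_scaleR_def det_row_mul[symmetric]
      by (rule arg_cong[of _ _ det]) (simp add: vec_eq_iff coframe_scale[OF assms])
  qed
qed

lemma hodge_star_skew: "hodge_star_3 e T Y X = - hodge_star_3 e T X Y"
proof -
  have "volume_form e (vector [x, y, z, Y, X]) = - volume_form e (vector [x, y, z, X, Y])" for x y z
    by (rule volume_form_swap)
  then show ?thesis
    by (simp add: hodge_star_3_def sum_negf)
qed

lemma hodge_star_bilinear:
  assumes "is_frame e"
  shows "bilinear (hodge_star_3 e T)"
proof -
  have scale: "linear (\<lambda>X. r * L X)" if "linear L" for r :: real and L :: "'a \<Rightarrow> real"
    using that by (auto simp: linear_iff algebra_simps)
  have lin: "linear (\<lambda>X. hodge_star_3 e T X Y)" for Y
    unfolding hodge_star_3_def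
    by (intro scale linear_compose_sum ballI volume_form_linear assms)
  have "linear (hodge_star_3 e T X)" for X
  proof -
    have "hodge_star_3 e T X = (\<lambda>Y. - hodge_star_3 e T Y X)"
      by (rule ext) (rule hodge_star_skew)
    then show ?thesis
      by (simp only: linear_compose_neg[OF lin])
  qed
  then show ?thesis
    using lin by (simp add: bilinear_def)
qed

text \<open>Reindexing the triple sum by \<open>p\<close> leaves only the six orderings of 1, 2, 3.
  Their summands are equal, since both factors change sign together, and this cancels the factor
  1/6.\<close>

lemma hodge_star_frame:
  assumes e: "is_frame e" and skew: "totally_skew T" and p: "p permutes UNIV"
  shows "hodge_star_3 e T (e (p 4)) (e (p 5)) = of_int (sign p) * T (e (p 1)) (e (p 2)) (e (p 3))"
proof -
  have reindex: "(\<Sum>i\<in>UNIV. g i) = (\<Sum>i\<in>UNIV. g (p i))" for g :: "5 \<Rightarrow> real"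
    by (rule sum.permute[OF p, unfolded o_def])
  define V where "V i j k = volume_form e (vector [e (p i), e (p j), e (p k), e (p 4), e (p 5)])" for i j k
  have "vector [e (p 1), e (p 2), e (p 3), e (p 4), e (p 5)] = (\<chi> j. e (p j))"
    unfolding vec_eq_iff forall_5 vec_lambda_beta vector_5 by simp
  then have V: "V 1 2 3 = of_int (sign p)"
    by (simp add: V_def volume_form_frame[OF e p])
  have V0: "V i i k = 0" "V i k k = 0" "V i k i = 0" "V 4 j k = 0" "V j 4 k = 0" "V j k 4 = 0"
    "V 5 j k = 0" "V j 5 k = 0" "V j k 5 = 0" for i j k
    unfolding V_def
    by (rule volume_form_repeat[of 1 2] volume_form_repeat[of 2 3] volume_form_repeat[of 1 3]
        volume_form_repeat[of 1 4] volume_form_repeat[of 2 4] volume_form_repeat[of 3 4]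
        volume_form_repeat[of 1 5] volume_form_repeat[of 2 5] volume_form_repeat[of 3 5];
        simp only: vector_5 distinct_5 not_False_eq_True)+
  have V_swap: "V i k j = - V i j k" "V j i k = - V i j k" for i j k
    by (simp_all only: V_def volume_form_swap(1)[of e "e (p j)" "e (p i)"] volume_form_swap(2)[of e _ "e (p k)" "e (p j)"])
  have Vp: "V 1 3 2 = - V 1 2 3" "V 2 1 3 = - V 1 2 3" "V 2 3 1 = V 1 2 3" "V 3 1 2 = V 1 2 3" "V 3 2 1 = - V 1 2 3"
    using V_swap by (metis minus_minus)+
  have T_swap: "T X Z Y = - T X Y Z" "T Y X Z = - T X Y Z" for X Y Z
    using skew unfolding totally_skew_def by metis+
  have Tp: "T X Z Y = - T X Y Z" "T Y X Z = - T X Y Z" "T Y Z X = T X Y Z" "T Z X Y = T X Y Z" "T Z Y X = - T X Y Z" for X Y Z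
    using T_swap by (metis minus_minus)+
  have "hodge_star_3 e T (e (p 4)) (e (p 5)) =
    1/6 * (\<Sum>i\<in>UNIV. \<Sum>j\<in>UNIV. \<Sum>k\<in>UNIV. T (e (p i)) (e (p j)) (e (p k)) * V i j k)"
    unfolding hodge_star_3_def V_def
    by (subst reindex, subst (2) reindex, subst (3) reindex) (rule refl)
  also have "\<dots> = V 1 2 3 * T (e (p 1)) (e (p 2)) (e (p 3))"
    using Tp(1-5)[of "e (p 1)" "e (p 3)" "e (p 2)"] Tp(1-5)[of "e (p 1)" "e (p 2)" "e (p 3)"]
    by (simp add: sum_5 V0 Vp)
  finally show ?thesis
    by (simp add: V)
qed

section \<open>Coclosedness of the torsion\<close>

text \<open>The derivative is trilinear and alternating, so its ten components on increasing triples
  determine it.\<close>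

lemma ext_deriv_2_eq_0:
  assumes f: "is_frame f" and br: "lie_algebra br" and \<beta>: "bilinear \<beta>" "\<And>X Y. \<beta> Y X = - \<beta> X Y"
    and zero: "ext_deriv_2 br \<beta> (f 1) (f 2) (f 3) = 0" "ext_deriv_2 br \<beta> (f 1) (f 2) (f 4) = 0"
      "ext_deriv_2 br \<beta> (f 1) (f 2) (f 5) = 0" "ext_deriv_2 br \<beta> (f 1) (f 3) (f 4) = 0"
      "ext_deriv_2 br \<beta> (f 1) (f 3) (f 5) = 0" "ext_deriv_2 br \<beta> (f 1) (f 4) (f 5) = 0"
      "ext_deriv_2 br \<beta> (f 2) (f 3) (f 4) = 0" "ext_deriv_2 br \<beta> (f 2) (f 3) (f 5) = 0"
      "ext_deriv_2 br \<beta> (f 2) (f 4) (f 5) = 0" "ext_deriv_2 br \<beta> (f 3) (f 4) (f 5) = 0"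
  shows "ext_deriv_2 br \<beta> X Y Z = 0"
proof -
  let ?d = "ext_deriv_2 br \<beta>"
  note lin = bilinear_simps[OF lie_algebra_bilinear[OF br]] bilinear_simps[OF \<beta>(1)]
  have swap: "?d Y X Z = - ?d X Y Z" "?d X Z Y = - ?d X Y Z" for X Y Z
    using lie_algebra_skew[OF br, of Y X] lie_algebra_skew[OF br, of Z Y]
    by (simp_all add: ext_deriv_2_def lin)
  have rep: "?d X X Z = 0" "?d X Z Z = 0" "?d X Z X = 0" for X Z
    using swap(1)[of X X Z] swap(2)[of X Z Z] swap(1)[of X Z X] swap(2)[of Z X X] by simp_all
  have linear: "linear (\<lambda>X. ?d X Y Z)" "linear (\<lambda>X. ?d Y X Z)" "linear (\<lambda>X. ?d Y Z X)" for Y Z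
    by (auto simp: linear_iff ext_deriv_2_def lin algebra_simps)
  have perm: "?d Y X Z = 0 \<and> ?d X Z Y = 0 \<and> ?d Y Z X = 0 \<and> ?d Z X Y = 0 \<and> ?d Z Y X = 0"
    if "?d X Y Z = 0" for X Y Z
    using that swap(1)[of X Y Z] swap(2)[of X Y Z] swap(2)[of Y X Z] swap(1)[of X Z Y] swap(1)[of Y Z X] by simp
  note zero' = zero zero[THEN perm, THEN conjunct1] zero[THEN perm, THEN conjunct2, THEN conjunct1]
    zero[THEN perm, THEN conjunct2, THEN conjunct2, THEN conjunct1]
    zero[THEN perm, THEN conjunct2, THEN conjunct2, THEN conjunct2, THEN conjunct1]
    zero[THEN perm, THEN conjunct2, THEN conjunct2, THEN conjunct2, THEN conjunct2]
  have "\<forall>i. \<forall>j. \<forall>k. ?d (f i) (f j) (f k) = 0"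
    unfolding forall_5 rep zero' by simp
  then have 1: "?d (f i) (f j) (f k) = 0" for i j k
    by blast
  have 2: "?d (f i) (f j) Z = 0" for i j Z
    by (rule linear_eq_0_on_frame[OF f linear(3)]) (rule 1)
  have "?d (f i) Y Z = 0" for i Y Z
    by (rule linear_eq_0_on_frame[OF f linear(2)]) (rule 2)
  then show ?thesis
    by (rule linear_eq_0_on_frame[OF f linear(1)])
qed

context so3_bracket
begin

text \<open>When the obstructions vanish, parity leaves only the components 124, 135, 235 and 345 of
  the derivative; the four equations of the second alternative state that these are zero. When the
  connection parameters vanish, all ten components cancel identically.\<close>

lemma coclosed:
  assumes \<beta>: "bilinear \<beta>" "\<And>X Y. \<beta> Y X = - \<beta> X Y"
    and star_f: "\<beta> (f 1) (f 2) = 3 * r" "\<beta> (f 1) (f 3) = - 3 * G" "\<beta> (f 1) (f 4) = 3 * q"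
      "\<beta> (f 1) (f 5) = - 3 * F" "\<beta> (f 2) (f 3) = E" "\<beta> (f 2) (f 4) = - t" "\<beta> (f 2) (f 5) = C"
      "\<beta> (f 3) (f 4) = B" "\<beta> (f 3) (f 5) = - c" "\<beta> (f 4) (f 5) = A"
    and cases_zero: "a = 0 \<and> b = 0 \<and> d = 0 \<and> P = 0 \<and> Q = 0 \<and> R = 0 \<and> S = 0 \<or>
      A = 0 \<and> B = 0 \<and> C = 0 \<and> E = 0 \<and> F = 0 \<and> G = 0 \<and> b * r + d * q = 0 \<and>
        P * c + R * r + S * q = 0 \<and> 3 * Q * r = S * (c - t) \<and> 3 * Q * q = R * (t - c)"
  shows "ext_deriv_2 br \<beta> X Y Z = 0"
proof -
  have skew: "\<beta> (f 2) (f 1) = - \<beta> (f 1) (f 2)" "\<beta> (f 3) (f 1) = - \<beta> (f 1) (f 3)"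
    "\<beta> (f 4) (f 1) = - \<beta> (f 1) (f 4)" "\<beta> (f 5) (f 1) = - \<beta> (f 1) (f 5)"
    "\<beta> (f 3) (f 2) = - \<beta> (f 2) (f 3)" "\<beta> (f 4) (f 2) = - \<beta> (f 2) (f 4)"
    "\<beta> (f 5) (f 2) = - \<beta> (f 2) (f 5)" "\<beta> (f 4) (f 3) = - \<beta> (f 3) (f 4)"
    "\<beta> (f 5) (f 3) = - \<beta> (f 3) (f 5)" "\<beta> (f 5) (f 4) = - \<beta> (f 4) (f 5)"
    by (rule \<beta>(2))+
  have self: "\<beta> X X = 0" for X
    using \<beta>(2)[of X X] by simp
  note simps = ext_deriv_2_def bracket_simps bilinear_simps[OF \<beta>(1)] skew self star_f
  show ?thesis
    using cases_zero
  proof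
    assume "a = 0 \<and> b = 0 \<and> d = 0 \<and> P = 0 \<and> Q = 0 \<and> R = 0 \<and> S = 0"
    then show ?thesis
      by - (rule ext_deriv_2_eq_0[OF frame lie \<beta>]; simp add: simps algebra_simps)
  next
    assume *: "A = 0 \<and> B = 0 \<and> C = 0 \<and> E = 0 \<and> F = 0 \<and> G = 0 \<and> b * r + d * q = 0 \<and>
        P * c + R * r + S * q = 0 \<and> 3 * Q * r = S * (c - t) \<and> 3 * Q * q = R * (t - c)"
    then have zero: "A = 0" "B = 0" "C = 0" "E = 0" "F = 0" "G = 0"
      by simp_all
    have "b * r + d * q = 0" "P * c + R * r + S * q = 0" "3 * Q * r = S * (c - t)" "3 * Q * q = R * (t - c)"
      using * by simp_all
    then have "6 * (b * r) + 6 * (d * q) = 0" "P * c + R * r + S * q = 0" "3 * (Q * r) = S * c - S * t"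
      "3 * (Q * q) = R * t - R * c"
      by (simp_all add: algebra_simps)
    then show ?thesis
      by - (rule ext_deriv_2_eq_0[OF frame lie \<beta>]; simp add: simps zero algebra_simps)
  qed
qed

text \<open>The first four equations are those required by \<open>coclosed\<close>; they are checked
  family by family, together with the isomorphism type. The flat family is excluded because its
  algebra is read off from the torsion three-form instead.\<close>

lemma symmetric_classification:
  assumes odd: "A = 0" "B = 0" "C = 0" "E = 0" "F = 0" "G = 0"
    and not_flat: "\<not> (a = 0 \<and> b = 0 \<and> d = 0 \<and> P = 0 \<and> Q = 0 \<and> R = 0 \<and> S = 0)"
  shows "(b * r + d * q = 0 \<and> P * c + R * r + S * q = 0 \<and> 3 * Q * r = S * (c - t) \<and> 3 * Q * q = R * (t - c)) \<and>
    (lie_solvable br \<or> iso_l2 br \<or> iso_so3_plus_s2 br)"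
  using odd
proof (cases rule: symmetric_cases)
  case flat
  then show ?thesis
    using not_flat by simp
next
  case semidirect
  then show ?thesis
    using l2_leaf[OF odd] by simp
next
  case so3_s2
  show ?thesis
  proof (cases "b = 0 \<and> d = 0")
    case True
    then have "t = a"
      using so3_s2(1,3) by (simp add: power2_eq_square)
    then show ?thesis
      using heisenberg_leaf[OF odd] so3_s2 True by simp
  next
    case False
    then show ?thesis
      using so3_s2_leaf[OF odd] so3_s2 by simp
  qed
next
  case solvable_a
  then show ?thesis
    using solvable_leaf_a[OF odd] by simp
next
  case solvable_P
  then show ?thesis
    using solvable_leaf_P[OF odd] by simp
next
  case solvable_Q
  then show ?thesis
    using solvable_leaf_Q[OF odd] by simp
next
  case solvable_R
  then show ?thesis
    using solvable_leaf_R[OF odd] by simp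
next
  case solvable_R'
  then show ?thesis
    using solvable_leaf_R'[OF odd] by simp
qed

end

lemma lie_solvable_abelian:
  assumes "lie_algebra br" and "is_frame e" and "\<And>i j. br (e i) (e j) = 0"
  shows "lie_solvable br"
  by (rule lie_solvableI[OF assms(1,2), of "{}" "{}" "{}"]) (simp_all add: assms(3))

section \<open>The classification\<close>

theorem theorem4p3:
  fixes br :: "'l::real_vector \<Rightarrow> 'l \<Rightarrow> 'l"
    and e :: "5 \<Rightarrow> 'l"
    and g :: "'l \<Rightarrow> 'l \<Rightarrow> real"
    and S :: "'l \<Rightarrow> 'l \<Rightarrow> 'l \<Rightarrow> real"
    and D :: "'l \<Rightarrow> 'l \<Rightarrow> 'l"
    and T :: "'l \<Rightarrow> 'l \<Rightarrow> 'l \<Rightarrow> real"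
    and h p :: "'l set"
  assumes "lie_algebra br"
    and "so3_structure e g S"
    and "nearly_integrable br g S"
    and "characteristic_connection br g S D"
    and "T = torsion br g D"
    and "h = span {e 1, e 2, e 4}"
    and "p = span {e 3, e 5}"
    and "\<forall>X\<in>h. (\<forall>Z\<in>h. D X Z \<in> h) \<and> (\<forall>Z\<in>p. D X Z \<in> p)"
    and "\<forall>Y\<in>p. (\<forall>Z\<in>h. D Y Z \<in> p) \<and> (\<forall>Z\<in>p. D Y Z \<in> h)"
  shows "(\<forall>X Y Z. ext_deriv_2 br (hodge_star_3 e T) X Y Z = 0) \<and>
    (symmetric_pair br h p \<longrightarrow>
       lie_solvable br \<or> iso_so3_plus_R2 br \<or> iso_l2 br \<or> iso_so3_plus_s2 br) \<and>
    (\<not> symmetric_pair br h p \<longrightarrow>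
       (\<forall>i j. D (e i) (e j) = 0) \<and> iso_so3_plus_R2 br)"
proof -
  note br = \<open>lie_algebra br\<close> and str = \<open>so3_structure e g S\<close> and con = \<open>characteristic_connection br g S D\<close>
  have frame_e: "is_frame e" and g: "g = frame_metric e"
    using str by (auto simp: so3_structure_def)
  define f where "f = e(1 := sqrt 3 *\<^sub>R e 1)"
  have f: "f 1 = sqrt 3 *\<^sub>R e 1" "f 2 = e 2" "f 3 = e 3" "f 4 = e 4" "f 5 = e 5"
    by (simp_all add: f_def)
  define c where "c = sqrt 3 * T (e 1) (e 2) (e 4)"
  define t where "t = sqrt 3 * T (e 1) (e 3) (e 5)"
  define q where "q = T (e 2) (e 3) (e 5)"
  define r where "r = T (e 3) (e 4) (e 5)"
  define A where "A = sqrt 3 * T (e 1) (e 2) (e 3)"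
  define B where "B = sqrt 3 * T (e 1) (e 2) (e 5)"
  define C where "C = sqrt 3 * T (e 1) (e 3) (e 4)"
  define E where "E = sqrt 3 * T (e 1) (e 4) (e 5)"
  define F where "F = T (e 2) (e 3) (e 4)"
  define G where "G = T (e 2) (e 4) (e 5)"
  obtain P Q R U a b d where so3: "so3_bracket br f P Q R U a b d c t q r A B C E F G"
    and D0: "a = 0 \<Longrightarrow> b = 0 \<Longrightarrow> d = 0 \<Longrightarrow> P = 0 \<Longrightarrow> Q = 0 \<Longrightarrow> R = 0 \<Longrightarrow> U = 0 \<Longrightarrow> \<forall>i j. D (e i) (e j) = 0"
    using so3_structure_bracket[OF br str con assms(5-9)]
    unfolding f_def c_def t_def q_def r_def A_def B_def C_def E_def F_def G_def by blast
  interpret so3_bracket br f P Q R U a b d c t q r A B C E F G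
    by (fact so3)
  let ?flat = "a = 0 \<and> b = 0 \<and> d = 0 \<and> P = 0 \<and> Q = 0 \<and> R = 0 \<and> U = 0"
  let ?odd = "A = 0 \<and> B = 0 \<and> C = 0 \<and> E = 0 \<and> F = 0 \<and> G = 0"
  have T_skew: "totally_skew T"
    using con assms(5) by (simp add: characteristic_connection_def)
  then have T_swap: "T X Y Z = - T Y X Z" "T X Y Z = - T X Z Y" for X Y Z
    unfolding totally_skew_def by blast+

  \<comment> \<open>The solvable alternative records \<open>?odd\<close>: it occurs only when the
    torsion vanishes on the frame. Without symmetry it is thereby excluded, and only \<ss>\<oo>(3)
    \<oplus> \<real>^2 remains.\<close>
  have flat: "(\<forall>i j. D (e i) (e j) = 0) \<and> (lie_solvable br \<and> ?odd \<or> iso_so3_plus_R2 br)" if ?flat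
  proof -
    have D: "\<forall>i j. D (e i) (e j) = 0"
      using D0 that by blast
    then have "T (e i) (e j) (e k) = - coframe e k (br (e i) (e j))" for i j k
      by (simp add: assms(5) torsion_def g frame_metric_basis[OF frame_e] coframe_neg[OF frame_e])
    then have bracket: "br (e i) (e j) = - (\<Sum>k\<in>UNIV. T (e i) (e j) (e k) *\<^sub>R e k)" for i j
      using coframe_expansion[OF frame_e, of "br (e i) (e j)", symmetric] by (simp add: sum_negf)
    have "lie_solvable br \<and> ?odd \<or> iso_so3_plus_R2 br"
    proof (cases "\<forall>i j k. T (e i) (e j) (e k) = 0")
      case True
      then show ?thesis
        using bracket lie_solvable_abelian[OF br frame_e]
        by (simp add: A_def B_def C_def E_def F_def G_def)
    next
      case False
      then obtain i j k where "T (e i) (e j) (e k) \<noteq> 0"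
        by blast
      then show ?thesis
        using iso_so3_plus_R2_skew[OF br frame_e, of "\<lambda>i j k. T (e i) (e j) (e k)", OF bracket T_swap] by blast
    qed
    then show ?thesis
      using D by blast
  qed

  have symmetric: "symmetric_pair br h p \<longleftrightarrow> ?odd"
  proof
    assume sym: "symmetric_pair br h p"
    have in_h: "f 1 \<in> h" "f 2 \<in> h" "f 4 \<in> h"
      by (simp_all add: assms(6) f span_base span_scale)
    have "br X Y \<in> h" if "X \<in> h" "Y \<in> h" for X Y
      using sym that by (simp add: symmetric_pair_def)
    then have "coframe e 3 (br X Y) = 0" "coframe e 5 (br X Y) = 0" if "X \<in> h" "Y \<in> h" for X Y
      using span_124[OF frame_e] that assms(6) by simp_all
    \<comment> \<open>The \<open>e 3\<close> and \<open>e 5\<close> components of these three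
      brackets are, up to sign and scaling, exactly the six obstructions.\<close>
    note * = this[OF in_h(1) in_h(2)] this[OF in_h(1) in_h(3)] this[OF in_h(2) in_h(3)]
    show ?odd
      using *[unfolded br12 br14 br24] by (simp add: f coframe_simps[OF frame_e] distinct_5)
  next
    assume ?odd
    then have zero: "A = 0" "B = 0" "C = 0" "E = 0" "F = 0" "G = 0"
      by simp_all
    have "e 1 = (1 / sqrt 3) *\<^sub>R f 1"
      by (simp add: f)
    then have "e 1 \<in> span {f 1, f 2, f 4}"
      by (simp add: span_base span_scale)
    moreover have "f 1 \<in> span {e 1, e 2, e 4}"
      by (simp add: f span_base span_scale)
    ultimately have h: "h = span {f 1, f 2, f 4}"
      unfolding assms(6) span_eq by (auto simp: f(2-) span_base)
    have p: "p = span {f 3, f 5}"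
      by (simp add: assms(7) f)
    show "symmetric_pair br h p"
      unfolding symmetric_pair_def
    proof (intro conjI ballI allI)
      show "subspace h" "subspace p"
        by (simp_all add: assms(6,7) subspace_span)
      show "h \<inter> p = {0}"
      proof -
        have "X = 0" if "X \<in> h" "X \<in> p" for X
        proof (rule frame_eqI[OF frame_e])
          show "coframe e i X = coframe e i 0" for i
            using exhaust_5[of i] span_124[OF frame_e] span_35[OF frame_e] that
            by (auto simp: assms(6,7) coframe_zero[OF frame_e])
        qed
        then show ?thesis
          by (auto simp: assms(6,7) span_zero)
      qed
      show "\<exists>Y\<in>h. \<exists>Z\<in>p. X = Y + Z" for X
      proof (intro bexI)
        let ?c = "\<lambda>i. coframe f i X *\<^sub>R f i"
        show "X = (?c 1 + ?c 2 + ?c 4) + (?c 3 + ?c 5)"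
          using coframe_expansion[OF frame, of X] by (simp add: sum_5 algebra_simps)
        show "?c 1 + ?c 2 + ?c 4 \<in> h" "?c 3 + ?c 5 \<in> p"
          unfolding h p by (auto intro!: in_span simp: span_base)
      qed
      fix X Y
      show "br X Y \<in> h" if "X \<in> h" "Y \<in> h"
        using that unfolding h
        by (rule bilinear_span[OF lie_algebra_bilinear[OF br], rotated])
          (auto simp: bracket_simps zero span_base intro!: in_span)
      show "br X Y \<in> p" if "X \<in> h" "Y \<in> p"
        using that unfolding h p
        by (rule bilinear_span[OF lie_algebra_bilinear[OF br], rotated])
          (auto simp: bracket_simps zero span_base intro!: in_span)
      show "br X Y \<in> h" if "X \<in> p" "Y \<in> p"
        using that unfolding h p
        by (rule bilinear_span[OF lie_algebra_bilinear[OF br], rotated])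
          (auto simp: bracket_simps zero span_base intro!: in_span)
    qed
  qed

  have not_odd: "?flat" if "\<not> ?odd"
    by (rule flat_if_not_symmetric[OF that])

  have coclosed: "ext_deriv_2 br (hodge_star_3 e T) X Y Z = 0" for X Y Z
  proof -
    let ?H = "hodge_star_3 e T"
    \<comment> \<open>The factor \<open>sqrt 3\<close> matches the scaling of \<open>f 1\<close> and
      of the torsion parameters, so that the values of \<beta> on \<open>f\<close> are integral
      multiples of the parameters.\<close>
    define \<beta> where "\<beta> X Y = sqrt 3 * ?H X Y" for X Y
    note H = hodge_star_bilinear[OF frame_e, of T]
    have bil: "bilinear \<beta>"
      using H by (auto simp: bilinear_def linear_iff \<beta>_def algebra_simps)
    have skew: "\<beta> Y X = - \<beta> X Y" for X Y
      using hodge_star_skew[of e T Y X] by (simp add: \<beta>_def)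
    note star = hodge_star_frame[OF frame_e T_skew]
    have H45: "?H (e 4) (e 5) = T (e 1) (e 2) (e 3)"
      using star[OF permutes_id] by simp
    \<comment> \<open>Each component of the star comes from a permutation carrying 4 and 5 to the
      wanted pair: one transposition if the pair contains 4 or 5, a product of two
      otherwise.\<close>
    have H5: "?H (e i) (e 5) = - T (e (Transposition.transpose i 4 1)) (e (Transposition.transpose i 4 2)) (e (Transposition.transpose i 4 3))"
      if "i \<noteq> 4" "i \<noteq> 5" for i
      using star[OF permutes_swap_id[of i UNIV 4]] that by (simp add: sign_swap_id)
    have H4: "?H (e 4) (e i) = - T (e (Transposition.transpose i 5 1)) (e (Transposition.transpose i 5 2)) (e (Transposition.transpose i 5 3))"
      if "i \<noteq> 4" "i \<noteq> 5" for i
      using star[OF permutes_swap_id[of i UNIV 5]] that by (simp add: sign_swap_id)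
    have H3: "?H (e i) (e j) = T (e ((Transposition.transpose i 4 \<circ> Transposition.transpose j 5) 1))
        (e ((Transposition.transpose i 4 \<circ> Transposition.transpose j 5) 2))
        (e ((Transposition.transpose i 4 \<circ> Transposition.transpose j 5) 3))"
      if "i \<noteq> 4" "i \<noteq> 5" "j \<noteq> 4" "j \<noteq> 5" "i \<noteq> j" for i j
      using star[OF permutes_compose[OF permutes_swap_id[of j UNIV 5] permutes_swap_id[of i UNIV 4]]] that
      by (simp add: sign_swap_id sign_compose permutation_swap_id Transposition.transpose_def distinct_5)
    have star_e: "?H (e 1) (e 2) = T (e 4) (e 5) (e 3)" "?H (e 1) (e 3) = T (e 4) (e 2) (e 5)"
      "?H (e 2) (e 3) = T (e 1) (e 4) (e 5)"
      "?H (e 1) (e 5) = - T (e 4) (e 2) (e 3)" "?H (e 2) (e 5) = - T (e 1) (e 4) (e 3)"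
      "?H (e 3) (e 5) = - T (e 1) (e 2) (e 4)"
      "?H (e 4) (e 1) = - T (e 5) (e 2) (e 3)" "?H (e 4) (e 2) = - T (e 1) (e 5) (e 3)"
      "?H (e 4) (e 3) = - T (e 1) (e 2) (e 5)"
      using H3[of 1 2] H3[of 1 3] H3[of 2 3] H5[of 1] H5[of 2] H5[of 3] H4[of 1] H4[of 2] H4[of 3]
      by (simp_all add: Transposition.transpose_def distinct_5)
    have sorted: "T (e 4) (e 5) (e 3) = r" "T (e 4) (e 2) (e 5) = - G" "T (e 4) (e 2) (e 3) = F"
      "T (e 5) (e 2) (e 3) = q"
      unfolding r_def G_def F_def q_def using T_swap by (metis minus_minus)+
    have star_f: "\<beta> (f 1) (f 2) = 3 * r" "\<beta> (f 1) (f 3) = - 3 * G" "\<beta> (f 1) (f 4) = 3 * q"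
      "\<beta> (f 1) (f 5) = - 3 * F" "\<beta> (f 2) (f 3) = E" "\<beta> (f 2) (f 4) = - t" "\<beta> (f 2) (f 5) = C"
      "\<beta> (f 3) (f 4) = B" "\<beta> (f 3) (f 5) = - c" "\<beta> (f 4) (f 5) = A"
      using hodge_star_skew[of e T "e 1" "e 4"] hodge_star_skew[of e T "e 2" "e 4"] hodge_star_skew[of e T "e 3" "e 4"]
        T_swap(2)[of "e 1" "e 4" "e 3"] T_swap(2)[of "e 1" "e 5" "e 3"]
      by (simp_all add: \<beta>_def f bilinear_simps[OF H] star_e sorted H45 A_def B_def C_def E_def c_def t_def)
    have "?flat \<or> ?odd \<and> b * r + d * q = 0 \<and> P * c + R * r + U * q = 0 \<and> 3 * Q * r = U * (c - t) \<and>
        3 * Q * q = R * (t - c)"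
      using not_odd symmetric_classification by blast
    then have "ext_deriv_2 br \<beta> X Y Z = 0"
      by (intro coclosed[OF bil skew star_f]) argo
    moreover have "ext_deriv_2 br \<beta> X Y Z = sqrt 3 * ext_deriv_2 br ?H X Y Z"
      by (simp add: ext_deriv_2_def \<beta>_def algebra_simps)
    ultimately show ?thesis
      by simp
  qed
  have "lie_solvable br \<or> iso_so3_plus_R2 br \<or> iso_l2 br \<or> iso_so3_plus_s2 br" if ?odd
    using symmetric_classification flat that by blast
  moreover have "(\<forall>i j. D (e i) (e j) = 0) \<and> iso_so3_plus_R2 br" if "\<not> ?odd"
    using flat not_odd that by blast
  ultimately show ?thesis
    using coclosed symmetric by blast
qed

end
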